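(* Let $\mathcal{L}=\mathcal{L}_{2,d}(m_1,\dots,m_5)$ be a non-empty linear system of plane curves based at $5$ points $p_1,\dots,p_5\in\mathbb{P}^2$ in general position, and let $C$ be the conic through the five points. Then $\mathcal{L}$ is special only if its base locus contains either linear cycles $L_I$ or cones $\mathrm{J}(L_I,\sigma_t)$ over the secant varieties $\sigma_t$ of $C$. Moreover $$\dim(\mathcal{L})=\sigma\mathrm{ldim}(\mathcal{L}).$$
   Context: $\mathbb{P}^n$ is projective space over $\mathbb{C}$. The notation below is given for general $n$ and is used with $n=2$. $\mathcal{L}=\mathcal{L}_{n,d}(m_1,\dots,m_{n+3})$, with $d,m_i\ge0$ integers, is the linear system of degree-$d$ hypersurfaces of $\mathbb{P}^n$ with multiplicity at least $m_i$ at $p_i$, where $p_1,\dots,p_{n+3}$ are in general position. $\dim(\mathcal L)$ is the affine dimension, i.e. the dimension of the vector space of degree-$d$ forms defining it. The virtual dimension is $\mathrm{vdim}(\mathcal{L})=\binom{n+d}{n}-\sum_i\binom{n+m_i-1}{n}$, the expected dimension is $\max(\mathrm{vdim}(\mathcal L),0)$, and $\mathcal{L}$ is special if $\dim(\mathcal L)$ is strictly greater than the expected dimension. $C$ is the rational normal curve of degree $n$ through the $n+3$ points. $\sigma_t$ ($t\ge1$) is the closure of the union of the $\mathbb{P}^{t-1}$'s spanned by $t$ points of $C$, and $\sigma_0=\emptyset$. $L_I$ is the linear span of $\{p_i:i\in I\}$. $\mathrm{J}(L_I,\sigma_t)$ is the join of $L_I$ and $\sigma_t$, with $\mathrm J(L_I,\emptyset)=L_I$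 and $\mathrm J(\emptyset,\sigma_t)=\sigma_t$. Set $k_C=\sum_{i=1}^{n+3}m_i-nd$, $k_{I,\sigma_t}=\sum_{i\in I}m_i+t\,k_C-(|I|+t-1)d$ and $r_{I,\sigma_t}=|I|+2t-1$. Secant linear expected dimension: write $n=2l+\epsilon$, $\epsilon\in\{0,1\}$. The (affine) secant linear virtual dimension of $\mathcal L$ is $$\sum_{I,t}(-1)^{|I|}\binom{n+k_{I,\sigma_t}-r_{I,\sigma_t}-1}{n},$$ summed over all $I\subset\{1,\dots,n+3\}$ and $t$ with $0\le t\le l+\epsilon$ and $0\le|I|\le n-2t$, where $\binom{a}{n}=0$ if $a<n$. If $\mathcal L$ is contained in a linear system with negative secant linear virtual dimension, then $\sigma\mathrm{ldim}(\mathcal L)=0$. Otherwise $\sigma\mathrm{ldim}(\mathcal L)$ is the maximum of the secant linear virtual dimension of $\mathcal L$ and $0$. *)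

theory Defs
  imports "HOL-Analysis.Analysis" "HOL-Library.Function_Algebras"
begin

text \<open>
  Homogeneous coordinates on \<open>\<P>\<^sup>n\<close> over the complex numbers are vectors of type
  \<open>complex^'n\<close> with \<open>CARD('n) = n + 1\<close>. A point is given by a nonzero representative, and
  a subset of \<open>\<P>\<^sup>n\<close> by its affine cone, always including the origin; in particular the empty
  set is represented by \<open>{0}\<close>. Points are indexed by \<open>{1..n+3}\<close>.
\<close>

definition proj_dim :: "'n::finite itself \<Rightarrow> nat" where
  "proj_dim _ = CARD('n) - 1"

subsection \<open>Forms\<close>

text \<open>As the complex numbers are infinite, polynomials are identified with polynomial functions.\<close>

definition fscale :: "complex \<Rightarrow> ('v \<Rightarrow> complex) \<Rightarrow> 'v \<Rightarrow> complex" where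
  "fscale c f = (\<lambda>x. c * f x)"

global_interpretation fun_vs: vector_space fscale
  by unfold_locales (auto simp: fscale_def fun_eq_iff algebra_simps)

definition monomial :: "('n::finite \<Rightarrow> nat) \<Rightarrow> complex^'n \<Rightarrow> complex" where
  "monomial a x = (\<Prod>i\<in>UNIV. (x $ i) ^ a i)"

definition forms :: "nat \<Rightarrow> (complex^'n::finite \<Rightarrow> complex) set" where
  "forms d = fun_vs.span {monomial a | a. sum a UNIV = d}"

text \<open>Order of vanishing: the expansion of \<open>F\<close> around \<open>q\<close> has no terms of degree less than
  \<open>k\<close>. For a form \<open>F\<close> this does not depend on the representative \<open>q \<noteq> 0\<close> and is the
  multiplicity of the hypersurface \<open>F = 0\<close> at the point with coordinates \<open>q\<close>.\<close>

definition vanishes_to_order :: "nat \<Rightarrow> complex^'n::finite \<Rightarrow> (complex^'n \<Rightarrow> complex) \<Rightarrow> bool" where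
  "vanishes_to_order k q F \<longleftrightarrow>
     (\<lambda>x. F (q + x)) \<in> fun_vs.span {monomial a | a. k \<le> sum a UNIV}"

subsection \<open>Linear systems\<close>

text \<open>Every \<open>n+1\<close> of the \<open>n+3\<close> points span \<open>\<P>\<^sup>n\<close>.\<close>

definition general_position :: "(nat \<Rightarrow> complex^'n::finite) \<Rightarrow> bool" where
  "general_position p \<longleftrightarrow>
     (\<forall>J \<subseteq> {1..proj_dim TYPE('n) + 3}. card J = proj_dim TYPE('n) + 1 \<longrightarrow>
        inj_on p J \<and> vec.independent (p ` J))"

text \<open>The vector space of forms defining \<open>\<L>\<^bsub>n,d\<^esub>(m\<^sub>1,\<dots>,m\<^bsub>n+3\<^esub>)\<close>. It contains the zero form;
  the linear system is non-empty when this space is not \<open>{0}\<close>.\<close>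

definition linsys ::
  "(nat \<Rightarrow> complex^'n::finite) \<Rightarrow> nat \<Rightarrow> (nat \<Rightarrow> nat) \<Rightarrow> (complex^'n \<Rightarrow> complex) set" where
  "linsys p d m =
     {F \<in> forms d. \<forall>i \<in> {1..proj_dim TYPE('n) + 3}. vanishes_to_order (m i) (p i) F}"

definition linsys_dim :: "(nat \<Rightarrow> complex^'n::finite) \<Rightarrow> nat \<Rightarrow> (nat \<Rightarrow> nat) \<Rightarrow> nat" where
  "linsys_dim p d m = fun_vs.dim (linsys p d m)"

definition base_locus :: "(complex^'n::finite \<Rightarrow> complex) set \<Rightarrow> (complex^'n) set" where
  "base_locus L = insert 0 {x. \<forall>F \<in> L. F x = 0}"

definition vdim :: "nat \<Rightarrow> nat \<Rightarrow> (nat \<Rightarrow> nat) \<Rightarrow> int" where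
  "vdim n d m = int ((n + d) choose n) - (\<Sum>i = 1..n+3. int ((n + m i - 1) choose n))"

definition special :: "(nat \<Rightarrow> complex^'n::finite) \<Rightarrow> nat \<Rightarrow> (nat \<Rightarrow> nat) \<Rightarrow> bool" where
  "special p d m \<longleftrightarrow> int (linsys_dim p d m) > max (vdim (proj_dim TYPE('n)) d m) 0"

subsection \<open>Rational normal curves, secant varieties and joins\<close>

definition rational_normal_curve :: "(complex^'n::finite) set \<Rightarrow> bool" where
  "rational_normal_curve C \<longleftrightarrow>
     (\<exists>e :: nat \<Rightarrow> complex^'n. let n = proj_dim TYPE('n) in
        inj_on e {0..n} \<and> vec.independent (e ` {0..n}) \<and>
        C = {(\<Sum>j = 0..n. (u ^ j * v ^ (n - j)) *s e j) | u v. True})"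

definition zariski_closure :: "(complex^'n::finite) set \<Rightarrow> (complex^'n) set" where
  "zariski_closure X =
     insert 0 {x. \<forall>e. \<forall>F \<in> forms e. (\<forall>y \<in> X. F y = 0) \<longrightarrow> F x = 0}"

text \<open>For \<open>t = 0\<close> this is \<open>{0}\<close>, the empty subset of \<open>\<P>\<^sup>n\<close>.\<close>

definition secant_variety :: "(complex^'n::finite) set \<Rightarrow> nat \<Rightarrow> (complex^'n) set" where
  "secant_variety C t =
     zariski_closure (\<Union>c \<in> {c. \<forall>i<t. c i \<in> C}. vec.span (c ` {..<t}))"

definition linear_cycle :: "(nat \<Rightarrow> complex^'n::finite) \<Rightarrow> nat set \<Rightarrow> (complex^'n) set" where
  "linear_cycle p I = vec.span (p ` I)"

text \<open>The sums \<open>x + y\<close> of vectors of two cones sweep out the lines joining their points. Joining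
  with \<open>{0}\<close>, the empty set, returns the other closed set.\<close>

definition proj_join :: "(complex^'n::finite) set \<Rightarrow> (complex^'n) set \<Rightarrow> (complex^'n) set" where
  "proj_join X Y = zariski_closure {x + y | x y. x \<in> X \<and> y \<in> Y}"

subsection \<open>Secant linear expected dimension\<close>

definition kC :: "nat \<Rightarrow> nat \<Rightarrow> (nat \<Rightarrow> nat) \<Rightarrow> int" where
  "kC n d m = (\<Sum>i = 1..n+3. int (m i)) - int n * int d"

definition k_sec :: "nat \<Rightarrow> nat \<Rightarrow> (nat \<Rightarrow> nat) \<Rightarrow> nat set \<Rightarrow> nat \<Rightarrow> int" where
  "k_sec n d m I t =
     (\<Sum>i\<in>I. int (m i)) + int t * kC n d m - (int (card I) + int t - 1) * int d"

text \<open>The dimension of \<open>J(L\<^sub>I, \<sigma>\<^sub>t)\<close> in the range of \<open>sec_indices\<close>. The condition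
  \<open>r_sec I 0 \<ge> 1\<close> singles out the linear cycles of positive dimension: base points with
  \<open>m\<^sub>i > 0\<close> always lie in the base locus, and their effect on the dimension is already part
  of \<open>vdim\<close>.\<close>

definition r_sec :: "nat set \<Rightarrow> nat \<Rightarrow> int" where
  "r_sec I t = int (card I) + 2 * int t - 1"

definition binom0 :: "int \<Rightarrow> nat \<Rightarrow> int" where
  "binom0 a n = (if a < int n then 0 else int (nat a choose n))"

definition sec_indices :: "nat \<Rightarrow> (nat set \<times> nat) set" where
  "sec_indices n =
     {(I, t). I \<subseteq> {1..n+3} \<and> t \<le> n div 2 + n mod 2 \<and> int (card I) \<le> int n - 2 * int t}"

definition sec_lin_vdim :: "nat \<Rightarrow> nat \<Rightarrow> (nat \<Rightarrow> nat) \<Rightarrow> int" where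
  "sec_lin_vdim n d m =
     (\<Sum>(I, t) \<in> sec_indices n.
        (- 1) ^ card I * binom0 (int n + k_sec n d m I t - r_sec I t - 1) n)"

text \<open>A system containing \<open>\<L>\<close> is one of the same degree based at the same points, with arbitrary
  multiplicities; containment is inclusion of the spaces of forms.\<close>

definition sec_ldim :: "(nat \<Rightarrow> complex^'n::finite) \<Rightarrow> nat \<Rightarrow> (nat \<Rightarrow> nat) \<Rightarrow> int" where
  "sec_ldim p d m =
     (let n = proj_dim TYPE('n) in
      if \<exists>m'. linsys p d m \<subseteq> linsys p d m' \<and> sec_lin_vdim n d m' < 0 then 0
      else max (sec_lin_vdim n d m) 0)"

end

theory Submission
  imports Defs "HOL-Computational_Algebra.Polynomial"
begin

text \<open>
  Blow up the plane in the five points. The result is a quartic del Pezzo surface, and the forms of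
  the linear system are the sections of the class \<open>D = d H - \<Sum> m\<^sub>i E\<^sub>i\<close>. Its \<open>(-1)\<close>-curves are the
  five exceptional curves, the ten lines through two of the points and the conic \<open>C\<close>. For a line or
  the conic \<open>E\<close>, the number \<open>k = - D.E\<close> (\<open>line_excess\<close>, \<open>conic_excess\<close>) is exactly the number \<open>k\<close> whose
  binomial coefficient \<open>k\<close> over 2 enters the secant linear virtual dimension, which is therefore
  the virtual dimension plus one correction term for each of these eleven curves
  (\<open>sec_lin_vdim_2\<close>). The claim to prove is that this number is the dimension of every non-empty
  system (\<open>linsys_dim_formula\<close>). The proof is an induction on the degree.

  If \<open>k > 0\<close> for some \<open>E\<close>, then by Bezout's theorem \<open>E\<close> is a component of every curve of the system, and
  \<open>D\<close> and \<open>D - E\<close> have the same dimension (\<open>fixed_curve_dim\<close>). They also have the same secant linear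
  virtual dimension (\<open>sec_lin_vdim_reduce_line\<close>, \<open>sec_lin_vdim_reduce_conic\<close>): the virtual dimension
  grows by \<open>k - 1\<close>, the correction term of \<open>E\<close> drops by \<open>k - 1\<close>, and the other terms do not change. For
  the last point one needs that a line meeting \<open>E\<close> outside the base points does not acquire a correction
  term. Such a line together with \<open>E\<close> is a member of the pencil of conics through four of the points, and an
  effective class has nonnegative degree on the members of a pencil (\<open>disjoint_lines_excess\<close>).

  If no \<open>k\<close> is positive, then the class is nef and the dimension is the virtual dimension. It is at
  least that, by a count of conditions (\<open>linsys_dim_ge_vdim\<close>). For the other inequality, restrict to
  the line \<open>E\<close> through the two points of largest multiplicity (\<open>linsys_dim_le_reduced\<close>). The restricted
  forms make up the expected \<open>D.E + 1\<close> dimensions at most, and \<open>D - E\<close>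
  is covered by the induction: its numbers \<open>k\<close> are at most 1, so there are no correction terms, and its
  virtual dimension is nonnegative (\<open>residual_vdim_nonneg\<close>), which takes care of the case that it is
  empty.

  Consequently every system that contains a non-empty one has nonnegative secant linear virtual
  dimension, and the secant linear expected dimension of a non-empty system is its secant linear
  virtual dimension.
  And if the system is special, then some correction term is nonzero; the corresponding line or
  conic has \<open>k > 0\<close> and lies in the base locus.

  All multiplicities are handled by restriction to polynomially parametrised curves, which turns
  statements on orders of vanishing into statements on divisibility of univariate polynomials.
\<close>

section \<open>Subspaces with finite spanning sets\<close>

lemma dim_le_of_subset_span:
  assumes "U \<subseteq> fun_vs.span V" "V \<subseteq> fun_vs.span T" "finite T"
  shows "fun_vs.dim U \<le> fun_vs.dim V"
proof -
  obtain B where B: "B \<subseteq> V" "fun_vs.independent B" "V \<subseteq> fun_vs.span B" "card B = fun_vs.dim V"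
    using fun_vs.basis_exists[of V] by blast
  have "B \<subseteq> fun_vs.span T" using B(1) assms(2) by (rule subset_trans)
  then have "finite B" using fun_vs.independent_span_bound[OF assms(3) B(2)] by simp
  have "U \<subseteq> fun_vs.span B"
    using assms(1) fun_vs.span_minimal[OF B(3) fun_vs.subspace_span] by (rule subset_trans)
  then have "fun_vs.dim U \<le> card B" using \<open>finite B\<close> by (rule fun_vs.dim_le_card)
  then show ?thesis by (simp only: B(4))
qed

lemma card_le_dim:
  assumes "fun_vs.independent B" "B \<subseteq> V" "V \<subseteq> fun_vs.span T" "finite T"
  shows "card B \<le> fun_vs.dim V"
proof -
  have "B \<subseteq> fun_vs.span V" using assms(2) fun_vs.span_superset[of V] by (rule subset_trans)
  then have "fun_vs.dim B \<le> fun_vs.dim V" using assms(3,4) by (rule dim_le_of_subset_span)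
  then show ?thesis using fun_vs.dim_eq_card_independent[OF assms(1)] by metis
qed

lemma finite_basis:
  assumes "V \<subseteq> fun_vs.span T" "finite T"
  obtains B where "finite B" "B \<subseteq> V" "fun_vs.independent B" "V \<subseteq> fun_vs.span B"
    "card B = fun_vs.dim V"
proof -
  obtain B where B: "B \<subseteq> V" "fun_vs.independent B" "V \<subseteq> fun_vs.span B" "card B = fun_vs.dim V"
    using fun_vs.basis_exists[of V] by blast
  have "B \<subseteq> fun_vs.span T" using B(1) assms(1) by (rule subset_trans)
  then have "finite B" using fun_vs.independent_span_bound[OF assms(2) B(2)] by simp
  then show ?thesis using B that by blast
qed

lemma dim_insert_le:
  assumes "V \<subseteq> fun_vs.span T" "finite T" "U \<subseteq> fun_vs.span (insert u V)"
  shows "fun_vs.dim U \<le> fun_vs.dim V + 1"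
proof -
  obtain B where B: "finite B" "B \<subseteq> V" "fun_vs.independent B" "V \<subseteq> fun_vs.span B"
    "card B = fun_vs.dim V"
    by (rule finite_basis[OF assms(1,2)])
  have "insert u V \<subseteq> fun_vs.span (insert u B)"
  proof (rule insert_subsetI)
    show "u \<in> fun_vs.span (insert u B)" by (rule fun_vs.span_base) simp
    have "fun_vs.span B \<subseteq> fun_vs.span (insert u B)" by (rule fun_vs.span_mono) blast
    with B(4) show "V \<subseteq> fun_vs.span (insert u B)" by (rule subset_trans)
  qed
  then have "fun_vs.span (insert u V) \<subseteq> fun_vs.span (insert u B)"
    by (rule fun_vs.span_minimal[OF _ fun_vs.subspace_span])
  with assms(3) have "U \<subseteq> fun_vs.span (insert u B)" by (rule subset_trans)
  then have "fun_vs.dim U \<le> card (insert u B)"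
    by (rule fun_vs.dim_le_card) (use B(1) in simp)
  also have "\<dots> \<le> card B + 1" using B(1) by (simp add: card_insert_if)
  finally show ?thesis using B(5) by simp
qed

text \<open>Every count of conditions below is an instance of this bound: \<open>W\<close> is the subspace cut out
  by the conditions, and \<open>T\<close> is a set of functions spanning a complement.\<close>

lemma dim_le_dim_Int_plus_card:
  assumes "fun_vs.subspace U" "fun_vs.subspace W" "U \<subseteq> fun_vs.span S" "finite S"
    and "finite T" "U \<subseteq> fun_vs.span (W \<union> T)"
  shows "fun_vs.dim U \<le> fun_vs.dim (U \<inter> W) + card T"
  using assms(5,1,3,6)
proof (induction T arbitrary: U rule: finite_induct)
  case empty
  have "fun_vs.span W = W" using assms(2) by (rule fun_vs.span_eq_iff[THEN iffD2])
  with empty have "U \<inter> W = U" by (metis Un_empty_right inf.absorb1)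
  then show ?case by simp
next
  case (insert t T)
  let ?W = "fun_vs.span (W \<union> T)"
  let ?U = "U \<inter> ?W"
  have fg: "?U \<subseteq> fun_vs.span S" using insert.prems by blast
  have sub: "fun_vs.subspace ?U"
    using insert.prems(1) fun_vs.subspace_span by (rule fun_vs.subspace_inter)
  have "fun_vs.dim U \<le> fun_vs.dim ?U + 1"
  proof (cases "U \<subseteq> ?W")
    case True
    then have "?U = U" by blast
    then show ?thesis by simp
  next
    case False
    then obtain u0 where u0: "u0 \<in> U" "u0 \<notin> ?W" by blast
    have br: "\<exists>k. u - fscale k t \<in> ?W" if "u \<in> U" for u
    proof -
      have "u \<in> fun_vs.span (insert t (W \<union> T))" using insert.prems(3) that by auto
      then show ?thesis using fun_vs.span_breakdown_eq by blast
    qed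
    obtain k0 where k0: "u0 - fscale k0 t \<in> ?W" using br u0 by blast
    have k0_nz: "k0 \<noteq> 0" using k0 u0(2) by (auto simp: fscale_def zero_fun_def[symmetric])
    have "U \<subseteq> fun_vs.span (insert u0 ?U)"
    proof
      fix u assume u: "u \<in> U"
      obtain k where k: "u - fscale k t \<in> ?W" using br u by blast
      define v where "v = u - fscale (k / k0) u0"
      have "v = (u - fscale k t) - fscale (k / k0) (u0 - fscale k0 t)"
        using k0_nz by (auto simp: v_def fscale_def fun_eq_iff field_simps)
      then have "v \<in> ?W" using k k0 by (simp add: fun_vs.span_diff fun_vs.span_scale)
      moreover have "v \<in> U" unfolding v_def
        using u u0(1) insert.prems(1) by (simp add: fun_vs.subspace_diff fun_vs.subspace_scale)
      ultimately have "v \<in> fun_vs.span ?U" by (simp add: fun_vs.span_base)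
      then show "u \<in> fun_vs.span (insert u0 ?U)"
        unfolding fun_vs.span_breakdown_eq v_def by blast
    qed
    then show ?thesis using dim_insert_le[OF fg assms(4)] by blast
  qed
  also have "fun_vs.dim ?U \<le> fun_vs.dim (?U \<inter> W) + card T"
    by (rule insert.IH[OF sub fg]) auto
  also have "?U \<inter> W = U \<inter> W" using fun_vs.span_superset[of "W \<union> T"] by blast
  finally show ?case using insert.hyps by simp
qed

text \<open>Vanishing at \<open>N\<close> points is \<open>N\<close> conditions on functions: the indicator functions of the
  points interpolate the values.\<close>

lemma dim_le_dim_vanishing_plus_card:
  assumes "fun_vs.subspace U" "U \<subseteq> fun_vs.span S" "finite S" "finite X"
  shows "fun_vs.dim U \<le> fun_vs.dim {F \<in> U. \<forall>x\<in>X. F x = 0} + card X"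
proof -
  define W where "W = {F :: 'a \<Rightarrow> complex. \<forall>x\<in>X. F x = 0}"
  define \<delta> :: "'a \<Rightarrow> 'a \<Rightarrow> complex" where "\<delta> = (\<lambda>x y. if y = x then 1 else 0)"
  have W: "fun_vs.subspace W"
    by (auto simp: W_def fun_vs.subspace_def fscale_def)
  have "U \<subseteq> fun_vs.span (W \<union> \<delta> ` X)"
  proof
    fix F assume "F \<in> U"
    define G where "G = (\<Sum>x\<in>X. fscale (F x) (\<delta> x))"
    have G: "G \<in> fun_vs.span (W \<union> \<delta> ` X)"
      unfolding G_def by (intro fun_vs.span_sum fun_vs.span_scale fun_vs.span_base) auto
    have "G y = F y" if "y \<in> X" for y
    proof -
      have "G y = (\<Sum>x\<in>X. fscale (F x) (\<delta> x) y)"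
        unfolding G_def using assms(4) by (induction X rule: finite_induct) auto
      also have "\<dots> = F y"
        using that assms(4) by (simp add: fscale_def \<delta>_def if_distrib[of "\<lambda>c. _ * c"] cong: if_cong)
      finally show ?thesis .
    qed
    then have "F - G \<in> W" by (auto simp: W_def)
    then have "F - G + G \<in> fun_vs.span (W \<union> \<delta> ` X)"
      using G by (intro fun_vs.span_add) (auto intro: fun_vs.span_base)
    then show "F \<in> fun_vs.span (W \<union> \<delta> ` X)" by simp
  qed
  then have "fun_vs.dim U \<le> fun_vs.dim (U \<inter> W) + card (\<delta> ` X)"
    using assms W by (intro dim_le_dim_Int_plus_card[of _ _ S]) auto
  also have "card (\<delta> ` X) \<le> card X" using assms(4) by (rule card_image_le)
  also have "U \<inter> W = {F \<in> U. \<forall>x\<in>X. F x = 0}" by (auto simp: W_def)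
  finally show ?thesis by simp
qed

lemma dim_image_mult_le:
  assumes "U \<subseteq> fun_vs.span S" "finite S"
  shows "fun_vs.dim ((\<lambda>F. P * F) ` U) \<le> fun_vs.dim U"
proof -
  obtain B where B: "finite B" "B \<subseteq> U" "fun_vs.independent B" "U \<subseteq> fun_vs.span B"
    "card B = fun_vs.dim U"
    by (rule finite_basis[OF assms])
  have "(\<lambda>F. P * F) ` U \<subseteq> fun_vs.span ((\<lambda>F. P * F) ` B)"
  proof
    fix H assume "H \<in> (\<lambda>F. P * F) ` U"
    then obtain F where F: "F \<in> fun_vs.span B" "H = P * F" using B(4) by blast
    have "P * F \<in> fun_vs.span ((\<lambda>F. P * F) ` B)" using F(1)
    proof (induction rule: fun_vs.span_induct_alt)
      case base
      then show ?case unfolding mult_zero_right by (rule fun_vs.span_zero)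
    next
      case (step c x y)
      have "P * (fscale c x + y) = fscale c (P * x) + P * y"
        by (auto simp: fscale_def fun_eq_iff algebra_simps)
      moreover have "P * x \<in> fun_vs.span ((\<lambda>F. P * F) ` B)"
        using step(1) by (intro fun_vs.span_base imageI)
      ultimately show ?case
        using step(2) by (metis fun_vs.span_add fun_vs.span_scale)
    qed
    then show "H \<in> fun_vs.span ((\<lambda>F. P * F) ` B)" using F by simp
  qed
  then have "fun_vs.dim ((\<lambda>F. P * F) ` U) \<le> card ((\<lambda>F. P * F) ` B)"
    using B(1) by (intro fun_vs.dim_le_card) auto
  also have "\<dots> \<le> card B" using B(1) by (rule card_image_le)
  finally show ?thesis using B(5) by simp
qed

lemma dim_image_mult_ge:
  assumes "U \<subseteq> fun_vs.span S" "finite S" "fun_vs.subspace U"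
    and inj: "\<And>F. F \<in> U \<Longrightarrow> P * F = 0 \<Longrightarrow> F = 0"
    and "(\<lambda>F. P * F) ` U \<subseteq> fun_vs.span T" "finite T"
  shows "fun_vs.dim U \<le> fun_vs.dim ((\<lambda>F. P * F) ` U)"
proof -
  obtain B where B: "finite B" "B \<subseteq> U" "fun_vs.independent B" "U \<subseteq> fun_vs.span B"
    "card B = fun_vs.dim U"
    by (rule finite_basis[OF assms(1,2)])
  have inj_on: "inj_on (\<lambda>F. P * F) U"
  proof (rule inj_onI)
    fix F G assume *: "F \<in> U" "G \<in> U" "P * F = P * G"
    have "P * (F - G) = 0" by (simp only: right_diff_distrib *(3) diff_self)
    with fun_vs.subspace_diff[OF assms(3) *(1,2)] have "F - G = 0" by (rule inj)
    then show "F = G" by (simp only: right_minus_eq)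
  qed
  have "fun_vs.independent ((\<lambda>F. P * F) ` B)"
    unfolding fun_vs.dependent_finite[OF finite_imageI[OF B(1)]]
  proof (rule notI, elim exE conjE)
    fix u assume u: "\<exists>v\<in>(\<lambda>F. P * F) ` B. u v \<noteq> 0"
      "(\<Sum>v\<in>(\<lambda>F. P * F) ` B. fscale (u v) v) = 0"
    define F where "F = (\<Sum>v\<in>B. fscale (u (P * v)) v)"
    have "P * F = (\<Sum>v\<in>B. fscale (u (P * v)) (P * v))"
      unfolding F_def sum_distrib_left
      by (intro sum.cong refl) (auto simp: fscale_def fun_eq_iff)
    also have "\<dots> = (\<Sum>v\<in>(\<lambda>F. P * F) ` B. fscale (u v) v)"
      by (subst sum.reindex[OF inj_on_subset[OF inj_on B(2)]]) (simp only: o_def)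
    finally have PF: "P * F = 0" by (simp only: u(2))
    have "F \<in> U" unfolding F_def
      by (intro fun_vs.subspace_sum[OF assms(3)] fun_vs.subspace_scale[OF assms(3)])
        (use B(2) in blast)
    from this PF have "F = 0" by (rule inj)
    moreover have "\<exists>v\<in>B. u (P * v) \<noteq> 0" using u(1) by (simp only: bex_simps)
    ultimately have "fun_vs.dependent B"
      unfolding F_def fun_vs.dependent_finite[OF B(1)] by (intro exI[of _ "\<lambda>v. u (P * v)"] conjI)
    then show False using B(3) by (rule notE[rotated])
  qed
  then have "card ((\<lambda>F. P * F) ` B) \<le> fun_vs.dim ((\<lambda>F. P * F) ` U)"
    by (rule card_le_dim[OF _ image_mono[OF B(2)] assms(5,6)])
  also have "card ((\<lambda>F. P * F) ` B) = card B"
    by (rule card_image[OF inj_on_subset[OF inj_on B(2)]])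
  finally show ?thesis by (simp only: B(5))
qed


section \<open>Forms and order of vanishing\<close>

text \<open>The powers of the ideal of the origin in the ring of polynomial functions; in particular
  \<open>order_ge 0\<close> is the whole ring.\<close>

definition order_ge :: "nat \<Rightarrow> (complex^'n::finite \<Rightarrow> complex) set" where
  "order_ge k = fun_vs.span {monomial a | a. k \<le> sum a UNIV}"

lemma vanishes_iff_order_ge: "vanishes_to_order k q F \<longleftrightarrow> (\<lambda>x. F (q + x)) \<in> order_ge k"
  by (simp only: vanishes_to_order_def order_ge_def)

lemma subspace_forms: "fun_vs.subspace (forms d)"
  unfolding forms_def by (rule fun_vs.subspace_span)

lemma subspace_order_ge: "fun_vs.subspace (order_ge k)"
  unfolding order_ge_def by (rule fun_vs.subspace_span)

lemma monomial_in_forms: "sum a UNIV = d \<Longrightarrow> monomial a \<in> forms d"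
  unfolding forms_def by (rule fun_vs.span_base) blast

lemma monomial_in_order_ge: "k \<le> sum a UNIV \<Longrightarrow> monomial a \<in> order_ge k"
  unfolding order_ge_def by (rule fun_vs.span_base) blast

lemma order_ge_antimono: "j \<le> k \<Longrightarrow> order_ge k \<subseteq> order_ge j"
  unfolding order_ge_def by (rule fun_vs.span_mono) auto

lemma forms_subset_order_ge: "k \<le> d \<Longrightarrow> forms d \<subseteq> order_ge k"
  unfolding order_ge_def forms_def by (rule fun_vs.span_mono) auto

lemma forms_polynomial: "F \<in> forms d \<Longrightarrow> F \<in> order_ge 0"
  using forms_subset_order_ge[of 0 d] by auto

lemma span_mult:
  assumes "F \<in> fun_vs.span S" "G \<in> fun_vs.span T"
    and "\<And>x y. x \<in> S \<Longrightarrow> y \<in> T \<Longrightarrow> (\<lambda>v. x v * y v) \<in> fun_vs.span R"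
  shows "(\<lambda>v. F v * G v) \<in> fun_vs.span R"
  using assms(1)
proof (induction rule: fun_vs.span_induct_alt)
  case base
  have "(\<lambda>v. (0 :: _ \<Rightarrow> complex) v * G v) = 0" by (simp add: fun_eq_iff)
  then show ?case by (metis fun_vs.span_zero)
next
  case (step c x y)
  have "(\<lambda>v. x v * G v) \<in> fun_vs.span R" using assms(2)
  proof (induction rule: fun_vs.span_induct_alt)
    case base
    have "(\<lambda>v. x v * (0 :: _ \<Rightarrow> complex) v) = 0" by (simp add: fun_eq_iff)
    then show ?case by (metis fun_vs.span_zero)
  next
    case (step b z w)
    have "(\<lambda>v. x v * (fscale b z + w) v) = fscale b (\<lambda>v. x v * z v) + (\<lambda>v. x v * w v)"
      by (simp add: fun_eq_iff fscale_def algebra_simps)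
    moreover have "fscale b (\<lambda>v. x v * z v) \<in> fun_vs.span R"
      by (rule fun_vs.span_scale) (rule assms(3)[OF \<open>x \<in> S\<close> step(1)])
    ultimately show ?case using step(2) by (metis fun_vs.span_add)
  qed
  then have "fscale c (\<lambda>v. x v * G v) \<in> fun_vs.span R" by (rule fun_vs.span_scale)
  moreover have "(\<lambda>v. (fscale c x + y) v * G v)
      = fscale c (\<lambda>v. x v * G v) + (\<lambda>v. y v * G v)"
    by (simp add: fun_eq_iff fscale_def algebra_simps)
  ultimately show ?case using step(2) by (metis fun_vs.span_add)
qed

lemma monomial_mult: "(\<lambda>x. monomial a x * monomial b x) = monomial (\<lambda>i. a i + b i)"
  by (simp add: fun_eq_iff monomial_def power_add prod.distrib)

lemma forms_mult:
  assumes "F \<in> forms d" "G \<in> forms e"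
  shows "(\<lambda>x. F x * G x) \<in> forms (d + e)"
  unfolding forms_def
proof (rule span_mult[OF assms[unfolded forms_def]])
  fix x y :: "complex^'a \<Rightarrow> complex"
  assume "x \<in> {monomial a |a. sum a UNIV = d}" "y \<in> {monomial a |a. sum a UNIV = e}"
  then obtain a b where "x = monomial a" "y = monomial b" "sum a UNIV = d" "sum b UNIV = e"
    by blast
  then show "(\<lambda>v. x v * y v) \<in> fun_vs.span {monomial a |a. sum a UNIV = d + e}"
    using monomial_in_forms[of "\<lambda>i. a i + b i" "d + e"]
    by (simp add: monomial_mult forms_def sum.distrib)
qed

lemma order_ge_mult:
  assumes "F \<in> order_ge j" "G \<in> order_ge k"
  shows "(\<lambda>x. F x * G x) \<in> order_ge (j + k)"
  unfolding order_ge_def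
proof (rule span_mult[OF assms[unfolded order_ge_def]])
  fix x y :: "complex^'a \<Rightarrow> complex"
  assume "x \<in> {monomial a |a. j \<le> sum a UNIV}" "y \<in> {monomial a |a. k \<le> sum a UNIV}"
  then obtain a b where "x = monomial a" "y = monomial b" "j \<le> sum a UNIV" "k \<le> sum b UNIV"
    by blast
  then show "(\<lambda>v. x v * y v) \<in> fun_vs.span {monomial a |a. j + k \<le> sum a UNIV}"
    using monomial_in_order_ge[of "j + k" "\<lambda>i. a i + b i"]
    by (simp add: monomial_mult order_ge_def sum.distrib add_mono)
qed

lemma const_in_forms: "(\<lambda>x. c) \<in> forms 0"
proof -
  have "fscale c (monomial (\<lambda>i. 0)) \<in> forms 0"
    by (intro fun_vs.subspace_scale[OF subspace_forms] monomial_in_forms) simp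
  then show ?thesis by (simp add: fscale_def monomial_def)
qed

lemma coordinate_in_forms: "(\<lambda>x :: complex^'n::finite. x $ i) \<in> forms 1"
proof -
  have "monomial (\<lambda>j. if j = i then 1 else 0) = (\<lambda>x :: complex^'n. x $ i)"
    by (simp add: monomial_def fun_eq_iff if_distrib[of "\<lambda>n. _ ^ n"] cong: if_cong)
  moreover have "monomial (\<lambda>j::'n. if j = i then 1 else 0) \<in> forms 1"
    by (rule monomial_in_forms) simp
  ultimately show ?thesis by simp
qed

lemma forms_add: "F \<in> forms d \<Longrightarrow> G \<in> forms d \<Longrightarrow> (\<lambda>x. F x + G x) \<in> forms d"
  using fun_vs.subspace_add[OF subspace_forms, of F d G] by (simp add: plus_fun_def)

lemma forms_scale: "F \<in> forms d \<Longrightarrow> (\<lambda>x. c * F x) \<in> forms d"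
  using fun_vs.subspace_scale[OF subspace_forms, of F d c] by (simp add: fscale_def)

lemma order_ge_add: "F \<in> order_ge k \<Longrightarrow> G \<in> order_ge k \<Longrightarrow> (\<lambda>x. F x + G x) \<in> order_ge k"
  using fun_vs.subspace_add[OF subspace_order_ge, of F k G] by (simp add: plus_fun_def)

lemma order_ge_diff: "F \<in> order_ge k \<Longrightarrow> G \<in> order_ge k \<Longrightarrow> (\<lambda>x. F x - G x) \<in> order_ge k"
  using fun_vs.subspace_diff[OF subspace_order_ge, of F k G] by (simp add: fun_diff_def)

lemma forms_sum:
  assumes "\<And>i. i \<in> I \<Longrightarrow> f i \<in> forms d"
  shows "(\<lambda>x. \<Sum>i\<in>I. f i x) \<in> forms d"
proof -
  have "sum f I \<in> forms d" by (rule fun_vs.subspace_sum[OF subspace_forms assms])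
  moreover have "sum f I = (\<lambda>x. \<Sum>i\<in>I. f i x)"
    by (induction I rule: infinite_finite_induct) (simp_all add: fun_eq_iff)
  ultimately show ?thesis by simp
qed

lemma linear_in_forms: "(\<lambda>x :: complex^'n::finite. (A *v x) $ i) \<in> forms 1"
  unfolding matrix_vector_mult_def vec_lambda_beta
  by (rule forms_sum, rule forms_scale, rule coordinate_in_forms)

lemma polynomial_mult:
  "F \<in> order_ge 0 \<Longrightarrow> G \<in> order_ge 0 \<Longrightarrow> (\<lambda>x. F x * G x) \<in> order_ge 0"
  using order_ge_mult[of F 0 G 0] by simp

lemma forms_power: "F \<in> forms d \<Longrightarrow> (\<lambda>x. F x ^ k) \<in> forms (d * k)"
  by (induction k) (auto simp: const_in_forms dest: forms_mult)

lemma polynomial_power: "F \<in> order_ge 0 \<Longrightarrow> (\<lambda>x. F x ^ k) \<in> order_ge 0"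
  by (induction k) (auto simp: forms_polynomial[OF const_in_forms] intro: polynomial_mult)

lemma forms_prod:
  "finite I \<Longrightarrow> (\<And>i. i \<in> I \<Longrightarrow> f i \<in> forms (a i)) \<Longrightarrow> (\<lambda>x. \<Prod>i\<in>I. f i x) \<in> forms (sum a I)"
  by (induction I rule: finite_induct) (auto simp: const_in_forms intro: forms_mult)

lemma polynomial_prod:
  "finite I \<Longrightarrow> (\<And>i. i \<in> I \<Longrightarrow> f i \<in> order_ge 0) \<Longrightarrow> (\<lambda>x. \<Prod>i\<in>I. f i x) \<in> order_ge 0"
  by (induction I rule: finite_induct)
     (auto simp: forms_polynomial[OF const_in_forms] intro: polynomial_mult)

lemma span_substitute:
  assumes "F \<in> fun_vs.span S" "\<And>x. x \<in> S \<Longrightarrow> (\<lambda>v. x (g v)) \<in> fun_vs.span R"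
  shows "(\<lambda>v. F (g v)) \<in> fun_vs.span R"
  using assms(1)
proof (induction rule: fun_vs.span_induct_alt)
  case base
  have "(\<lambda>v. (0 :: _ \<Rightarrow> complex) (g v)) = 0" by (simp add: fun_eq_iff)
  then show ?case by (metis fun_vs.span_zero)
next
  case (step c x y)
  have "(\<lambda>v. (fscale c x + y) (g v)) = fscale c (\<lambda>v. x (g v)) + (\<lambda>v. y (g v))"
    by (simp add: fun_eq_iff fscale_def)
  moreover have "fscale c (\<lambda>v. x (g v)) \<in> fun_vs.span R"
    by (rule fun_vs.span_scale) (rule assms(2)[OF step(1)])
  ultimately show ?case using step(2) by (metis fun_vs.span_add)
qed

lemma monomial_linear_substitute: "(\<lambda>x. monomial a (A *v x)) \<in> forms (sum a UNIV)"
  unfolding monomial_def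
proof (rule forms_prod)
  fix i
  show "(\<lambda>x. (A *v x) $ i ^ a i) \<in> forms (a i)"
    using forms_power[OF linear_in_forms, of A i "a i"] by simp
qed simp

lemma forms_linear_substitute:
  assumes "F \<in> forms d"
  shows "(\<lambda>x. F (A *v x)) \<in> forms d"
  unfolding forms_def
proof (rule span_substitute[OF assms[unfolded forms_def]])
  fix x :: "complex^'a \<Rightarrow> complex" assume "x \<in> {monomial a |a. sum a UNIV = d}"
  then show "(\<lambda>v. x (A *v v)) \<in> fun_vs.span {monomial a |a. sum a UNIV = d}"
    using monomial_linear_substitute by (auto simp: forms_def)
qed

lemma polynomial_translate:
  assumes "F \<in> order_ge 0"
  shows "(\<lambda>x. F (q + x)) \<in> order_ge 0"
  unfolding order_ge_def
proof (rule span_substitute[OF assms[unfolded order_ge_def]])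
  fix x :: "complex^'a \<Rightarrow> complex" assume "x \<in> {monomial a |a. 0 \<le> sum a UNIV}"
  then obtain a where a: "x = monomial a" by blast
  have "(\<lambda>v. \<Prod>i\<in>UNIV. (q $ i + v $ i) ^ a i) \<in> order_ge 0"
  proof (rule polynomial_prod, simp, rule polynomial_power, rule order_ge_add)
    show "(\<lambda>v. q $ i) \<in> order_ge 0" for i by (rule forms_polynomial[OF const_in_forms])
    show "(\<lambda>v. v $ i) \<in> order_ge 0" for i by (rule forms_polynomial[OF coordinate_in_forms])
  qed
  then show "(\<lambda>v. x (q + v)) \<in> fun_vs.span {monomial a |a. 0 \<le> sum a UNIV}"
    by (simp add: a monomial_def order_ge_def)
qed

lemma finite_exponents: "finite {a :: 'n::finite \<Rightarrow> nat. sum a UNIV = d}"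
proof (rule finite_subset)
  show "{a :: 'n \<Rightarrow> nat. sum a UNIV = d} \<subseteq> PiE UNIV (\<lambda>_. {..d})"
    by (auto intro: member_le_sum)
  show "finite (PiE (UNIV :: 'n set) (\<lambda>_. {..d}))" by (rule finite_PiE) auto
qed

lemma forms_fin_gen: "forms d \<subseteq> fun_vs.span (monomial ` {a. sum a UNIV = d})"
  unfolding forms_def by (rule fun_vs.span_mono) blast

lemma forms_homogeneous:
  assumes "F \<in> forms d"
  shows "F (c *s x) = c ^ d * F x"
  using assms unfolding forms_def
proof (induction rule: fun_vs.span_induct_alt)
  case (step b m G)
  then obtain a where "m = monomial a" "sum a UNIV = d" by blast
  then have "m (c *s x) = c ^ d * m x"
    by (simp add: monomial_def power_mult_distrib prod.distrib flip: power_sum)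
  then show ?case using step(2) by (simp add: fscale_def algebra_simps)
qed simp

text \<open>Splitting off the lowest form.\<close>

lemma order_ge_split:
  assumes "F \<in> order_ge k"
  shows "\<exists>G \<in> forms k. \<exists>R \<in> order_ge (Suc k). \<forall>x. F x = G x + R x"
  using assms[unfolded order_ge_def]
proof (induction rule: fun_vs.span_induct_alt)
  case base
  show ?case
    by (rule bexI[OF _ fun_vs.subspace_0[OF subspace_forms]],
        rule bexI[OF _ fun_vs.subspace_0[OF subspace_order_ge]]) simp
next
  case (step c m F)
  then obtain G R where GR: "G \<in> forms k" "R \<in> order_ge (Suc k)" "\<forall>x. F x = G x + R x"
    by blast
  obtain a where a: "m = monomial a" "k \<le> sum a UNIV" using step(1) by blast
  show ?case
  proof (cases "sum a UNIV = k")
    case True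
    have "(\<lambda>x. c * m x + G x) \<in> forms k"
      unfolding a using True GR(1) by (intro forms_add forms_scale monomial_in_forms)
    then show ?thesis using GR(2,3)
      by (intro bexI[of _ "\<lambda>x. c * m x + G x"] bexI[of _ R]) (auto simp: fscale_def)
  next
    case False
    have "fscale c m \<in> order_ge (Suc k)" unfolding a
      using False a(2) by (intro fun_vs.subspace_scale[OF subspace_order_ge] monomial_in_order_ge) simp
    then have "(\<lambda>x. fscale c m x + R x) \<in> order_ge (Suc k)" using GR(2) by (rule order_ge_add)
    then show ?thesis using GR(1,3)
      by (intro bexI[of _ G] bexI[of _ "\<lambda>x. fscale c m x + R x"]) auto
  qed
qed

section \<open>Restriction to parametrised curves\<close>

text \<open>The curve \<open>u w\<close> passes through the origin at the zeros of \<open>u\<close>, so an order of vanishing at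
  the origin becomes divisibility by a power of \<open>u\<close>. For \<open>u = 1\<close> this is plain restriction.\<close>

lemma order_ge_restrict:
  fixes w :: "'n::finite \<Rightarrow> complex poly"
  assumes "F \<in> order_ge k"
  shows "\<exists>r. \<forall>t. F (\<chi> i. poly u t * poly (w i) t) = poly u t ^ k * poly r t"
  using assms[unfolded order_ge_def]
proof (induction rule: fun_vs.span_induct_alt)
  case base
  show ?case by (rule exI[of _ 0]) simp
next
  case (step c m F)
  then obtain r where r: "\<forall>t. F (\<chi> i. poly u t * poly (w i) t) = poly u t ^ k * poly r t"
    by blast
  obtain a where a: "m = monomial a" "k \<le> sum a UNIV" using step(1) by blast
  have "m (\<chi> i. poly u t * poly (w i) t)
      = poly u t ^ k * poly (u ^ (sum a UNIV - k) * (\<Prod>i\<in>UNIV. w i ^ a i)) t" for t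
    using a(2) unfolding a(1) monomial_def
    by (simp add: power_mult_distrib prod.distrib poly_prod flip: power_sum power_add)
  then show ?case using r
    by (intro exI[of _ "smult c (u ^ (sum a UNIV - k) * (\<Prod>i\<in>UNIV. w i ^ a i)) + r"])
      (simp add: fscale_def algebra_simps)
qed

lemma forms_restrict:
  fixes w :: "'n::finite \<Rightarrow> complex poly"
  assumes "F \<in> forms d" "\<And>i. degree (w i) \<le> e"
  shows "\<exists>r. degree r \<le> e * d \<and> (\<forall>t. F (\<chi> i. poly (w i) t) = poly r t)"
  using assms(1)[unfolded forms_def]
proof (induction rule: fun_vs.span_induct_alt)
  case base
  show ?case by (rule exI[of _ 0]) simp
next
  case (step c m F)
  then obtain r where r: "degree r \<le> e * d" "\<forall>t. F (\<chi> i. poly (w i) t) = poly r t"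
    by blast
  obtain a where a: "m = monomial a" "sum a UNIV = d" using step(1) by blast
  define s where "s = (\<Prod>i\<in>UNIV. w i ^ a i)"
  have "degree s \<le> (\<Sum>i\<in>UNIV. degree (w i ^ a i))"
    unfolding s_def using degree_prod_sum_le[of UNIV "\<lambda>i. w i ^ a i"] by (simp add: o_def)
  also have "\<dots> \<le> (\<Sum>i\<in>UNIV. e * a i)"
    by (intro sum_mono order_trans[OF degree_power_le]) (simp add: assms(2) mult_right_mono)
  also have "\<dots> = e * d" by (simp add: a(2) flip: sum_distrib_left)
  finally have "degree s \<le> e * d" .
  moreover have "m (\<chi> i. poly (w i) t) = poly s t" for t
    unfolding a(1) monomial_def s_def by (simp add: poly_prod)
  ultimately show ?case using r
    by (intro exI[of _ "smult c s + r"])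
      (auto simp: fscale_def intro!: degree_add_le order_trans[OF degree_smult_le])
qed


lemma polynomial_on_line:
  assumes "F \<in> order_ge 0"
  shows "\<exists>r. \<forall>t. F (x + t *s v) = poly r t"
proof -
  obtain r where r: "\<And>t. F (\<chi> i. poly 1 t * poly [:x $ i, v $ i:] t) = poly 1 t ^ 0 * poly r t"
    using order_ge_restrict[OF assms, of 1 "\<lambda>i. [:x $ i, v $ i:]"] by blast
  have "(\<chi> i. poly 1 t * poly [:x $ i, v $ i:] t) = x + t *s v" for t
    by (simp add: vec_eq_iff)
  then show ?thesis using r by auto
qed

lemma order_ge_on_ray:
  assumes "F \<in> order_ge k"
  shows "\<exists>r. \<forall>t. F (t *s v) = t ^ k * poly r t"
proof -
  obtain r where r: "\<And>t. F (\<chi> i. poly [:0, 1:] t * poly [:v $ i:] t) = poly [:0, 1:] t ^ k * poly r t"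
    using order_ge_restrict[OF assms, of "[:0, 1:]" "\<lambda>i. [:v $ i:]"] by blast
  have "(\<chi> i. poly [:0, 1:] t * poly [:v $ i:] t) = t *s v" for t
    by (simp add: vec_eq_iff)
  then show ?thesis using r by auto
qed

text \<open>Polynomial functions form an integral domain: restrict both factors to the line joining a
  point where the first does not vanish to an arbitrary point.\<close>

lemma polynomial_mult_eq_0:
  assumes "F \<in> order_ge 0" "G \<in> order_ge 0" "\<And>x. F x * G x = 0" "F x0 \<noteq> 0"
  shows "G = 0"
proof
  fix y
  obtain f where f: "\<And>t. F (x0 + t *s (y - x0)) = poly f t"
    using polynomial_on_line[OF assms(1)] by blast
  obtain g where g: "\<And>t. G (x0 + t *s (y - x0)) = poly g t"
    using polynomial_on_line[OF assms(2)] by blast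
  have "poly (f * g) t = 0" for t
    using assms(3)[of "x0 + t *s (y - x0)"] by (simp only: f g poly_mult)
  then have "f * g = 0" using poly_all_0_iff_0 by blast
  moreover have "f \<noteq> 0" using f[of 0] assms(4) by auto
  ultimately have "g = 0" by simp
  then show "G y = 0 y" using g[of 1] by simp
qed

text \<open>Homogeneous components of different degrees are independent.\<close>

lemma forms_order_ge_Suc_eq_0:
  assumes "F \<in> forms d" "F \<in> order_ge (Suc d)"
  shows "F x = 0"
proof -
  obtain r where r: "\<And>t. F (t *s x) = t ^ Suc d * poly r t"
    using order_ge_on_ray[OF assms(2)] by blast
  have "poly (monom (F x) d) t = poly (monom 1 (Suc d) * r) t" for t
    using r[of t] by (simp add: forms_homogeneous[OF assms(1)] poly_monom mult.commute)
  then have "monom (F x) d = monom 1 (Suc d) * r" using poly_eq_poly_eq_iff by blast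
  then have "coeff (monom (F x) d) d = coeff (monom 1 (Suc d) * r) d" by simp
  then show ?thesis by (simp add: coeff_monom_mult)
qed

text \<open>Orders of vanishing are additive: the lowest form of a product is the product of the lowest
  forms.\<close>

lemma order_ge_cancel:
  assumes P: "P0 \<in> forms j" "P0 x0 \<noteq> 0" "R \<in> order_ge (Suc j)" "\<And>x. P x = P0 x + R x"
    and "G \<in> order_ge 0" "(\<lambda>x. P x * G x) \<in> order_ge (j + k)"
  shows "G \<in> order_ge k"
  using assms(6)
proof (induction k)
  case 0
  show ?case by (rule assms(5))
next
  case (Suc k)
  have "G \<in> order_ge k"
    using Suc.prems order_ge_antimono[of "j + k" "j + Suc k"] by (intro Suc.IH) auto
  then obtain G0 S where G0: "G0 \<in> forms k" "S \<in> order_ge (Suc k)" "\<And>x. G x = G0 x + S x"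
    using order_ge_split by blast
  have 1: "(\<lambda>x. R x * G x) \<in> order_ge (j + Suc k)"
    using order_ge_mult[OF P(3) \<open>G \<in> order_ge k\<close>] by simp
  have 2: "(\<lambda>x. P0 x * S x) \<in> order_ge (j + Suc k)"
    using order_ge_mult[OF subsetD[OF forms_subset_order_ge[OF order_refl] P(1)] G0(2)] .
  have "(\<lambda>x. P x * G x - R x * G x - P0 x * S x) \<in> order_ge (j + Suc k)"
    by (rule order_ge_diff[OF order_ge_diff[OF Suc.prems 1] 2])
  moreover have "(\<lambda>x. P x * G x - R x * G x - P0 x * S x) = (\<lambda>x. P0 x * G0 x)"
    by (simp add: fun_eq_iff P(4) G0(3) algebra_simps)
  ultimately have "(\<lambda>x. P0 x * G0 x) \<in> order_ge (Suc (j + k))" by simp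
  then have "P0 x * G0 x = 0" for x
    using forms_order_ge_Suc_eq_0[OF forms_mult[OF P(1) G0(1)]] by blast
  then have "G0 = 0"
    using polynomial_mult_eq_0[OF forms_polynomial[OF P(1)] forms_polynomial[OF G0(1)] _ P(2)]
    by blast
  then have "G = S" using G0(3) by (simp add: fun_eq_iff)
  then show ?case using G0(2) by simp
qed

lemma order_ge_at_0: "F \<in> order_ge (Suc k) \<Longrightarrow> F 0 = 0"
  using order_ge_on_ray[of F "Suc k" 0] by (metis mult_zero_left power_0_Suc vector_smult_rzero)

lemma order_ge_cancel_unit:
  assumes "P \<in> order_ge 0" "P 0 \<noteq> 0" "G \<in> order_ge 0" "(\<lambda>x. P x * G x) \<in> order_ge k"
  shows "G \<in> order_ge k"
proof -
  obtain P0 R where PR: "P0 \<in> forms 0" "R \<in> order_ge (Suc 0)" "\<And>x. P x = P0 x + R x"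
    using order_ge_split[OF assms(1)] by blast
  have "P0 0 \<noteq> 0" using order_ge_at_0[OF PR(2)] PR(3)[of 0] assms(2) by simp
  then show ?thesis using order_ge_cancel[OF PR(1) _ PR(2,3) assms(3), of 0 k] assms(4) by simp
qed

text \<open>On a line through \<open>q\<close> the form is a polynomial with a root of order exceeding its degree.\<close>

lemma vanishing_order_gt_degree:
  assumes "F \<in> forms d" "vanishes_to_order k q F" "d < k"
  shows "F = 0"
proof
  fix y
  have w: "degree [:q $ i, (y - q) $ i:] \<le> 1" for i
    by simp
  obtain r where r: "degree r \<le> 1 * d" "\<And>t. F (\<chi> i. poly [:q $ i, (y - q) $ i:] t) = poly r t"
    using forms_restrict[OF assms(1), of "\<lambda>i. [:q $ i, (y - q) $ i:]", OF w] by blast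
  obtain s where s: "\<And>t. F (q + t *s (y - q)) = t ^ k * poly s t"
    using order_ge_on_ray[OF assms(2)[unfolded vanishes_iff_order_ge]] by blast
  have "(\<chi> i. poly [:q $ i, (y - q) $ i:] t) = q + t *s (y - q)" for t
    by (simp add: vec_eq_iff algebra_simps)
  then have "poly r t = poly (monom 1 k * s) t" for t
    using r(2)[of t] s[of t] by (simp add: poly_monom)
  then have rs: "r = monom 1 k * s" using poly_eq_poly_eq_iff by blast
  have "s = 0"
  proof (rule ccontr)
    assume "s \<noteq> 0"
    then have "degree r = k + degree s" by (simp add: rs degree_mult_eq degree_monom_eq)
    then show False using r(1) assms(3) by simp
  qed
  then show "F y = 0 y" using s[of 1] by simp
qed

lemma poly_eq_0_of_many_roots:
  fixes r :: "complex poly"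
  assumes "finite I" "inj_on s I" "\<And>i. i \<in> I \<Longrightarrow> [:- s i, 1:] ^ n i dvd r"
    and "finite X" "X \<inter> s ` I = {}" "\<And>x. x \<in> X \<Longrightarrow> poly r x = 0"
    and "degree r < sum n I + card X"
  shows "r = 0"
proof (rule ccontr)
  assume r: "r \<noteq> 0"
  let ?Z = "{x. poly r x = 0}"
  have fin: "finite ?Z" using r by (rule poly_roots_finite)
  have "sum n I \<le> (\<Sum>i\<in>I. order (s i) r)"
  proof (rule sum_mono)
    fix i assume "i \<in> I"
    then have "[:- s i, 1:] ^ n i dvd r" by (rule assms(3))
    then show "n i \<le> order (s i) r" using r by (simp only: order_divides) simp
  qed
  also have "\<dots> = (\<Sum>x\<in>s ` I. order x r)" by (simp only: sum.reindex[OF assms(2)] o_def)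
  finally have 1: "sum n I \<le> (\<Sum>x\<in>s ` I. order x r)" .
  have "(\<Sum>x\<in>X. 1) \<le> (\<Sum>x\<in>X. order x r)"
  proof (rule sum_mono)
    fix x assume "x \<in> X"
    then have "order x r \<noteq> 0" using assms(6)[of x] r by (simp add: order_root)
    then show "1 \<le> order x r" by simp
  qed
  then have 2: "card X \<le> (\<Sum>x\<in>X. order x r)" by simp
  have "(\<Sum>x\<in>s ` I. order x r) + (\<Sum>x\<in>X. order x r) = (\<Sum>x\<in>s ` I \<union> X. order x r)"
  proof (rule sum.union_disjoint[symmetric])
    show "finite (s ` I)" using assms(1) by (rule finite_imageI)
    show "s ` I \<inter> X = {}" using assms(5) by (simp only: Int_commute)
  qed (rule assms(4))
  also have "\<dots> = (\<Sum>x\<in>(s ` I \<union> X) \<inter> ?Z. order x r)"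
    using assms(1,4) order_root[of r] r by (intro sum.mono_neutral_right) auto
  also have "\<dots> \<le> (\<Sum>x\<in>?Z. order x r)"
    using fin by (intro sum_mono2) auto
  also have "\<dots> \<le> degree r" using r by (rule sum_order_le_degree)
  finally show False using 1 2 assms(7) by simp
qed

text \<open>The difference between the curve and its point at \<open>a\<close> is divisible by \<open>t - a\<close>. The scalar \<open>\<mu>\<close>
  passes between two representatives of the same projective point.\<close>

lemma order_restrict_to_curve:
  fixes w :: "'n::finite \<Rightarrow> complex poly"
  assumes "F \<in> forms d" "vanishes_to_order k q F" "\<And>t. F (\<chi> i. poly (w i) t) = poly r t"
    and "q = \<mu> *s (\<chi> i. poly (w i) a)" "\<mu> \<noteq> 0"
  shows "[:- a, 1:] ^ k dvd r"
proof -
  have "\<exists>v. w i - [:poly (w i) a:] = [:- a, 1:] * v" for i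
    using poly_eq_0_iff_dvd[of "w i - [:poly (w i) a:]" a] by (auto simp: dvd_def)
  then obtain v where v: "\<And>i. w i - [:poly (w i) a:] = [:- a, 1:] * v i" by metis
  have v': "poly (w i) t - poly (w i) a = (t - a) * poly (v i) t" for i t
    using arg_cong[OF v[of i], of "\<lambda>p. poly p t"] by (simp add: algebra_simps)
  from order_ge_restrict[OF assms(2)[unfolded vanishes_iff_order_ge],
        of "[:- a, 1:]" "\<lambda>i. smult \<mu> (v i)"]
  obtain s where s: "\<forall>t. F (q + (\<chi> i. poly [:- a, 1:] t * poly (smult \<mu> (v i)) t))
      = poly [:- a, 1:] t ^ k * poly s t"
    by (rule exE)
  have "poly (smult (\<mu> ^ d) r) t = poly ([:- a, 1:] ^ k * s) t" for t
  proof -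
    have "q + (\<chi> i. poly [:- a, 1:] t * poly (smult \<mu> (v i)) t) = \<mu> *s (\<chi> i. poly (w i) t)"
    proof -
      have "\<mu> * poly (w i) a + (t - a) * (\<mu> * poly (v i) t)
          = \<mu> * (poly (w i) a + (poly (w i) t - poly (w i) a))" for i
        unfolding v' by (simp add: algebra_simps)
      then show ?thesis by (simp add: vec_eq_iff assms(4))
    qed
    then have "\<mu> ^ d * poly r t = poly [:- a, 1:] t ^ k * poly s t"
      using spec[OF s, of t] by (simp only: forms_homogeneous[OF assms(1)] assms(3))
    then show ?thesis by simp
  qed
  then have "smult (\<mu> ^ d) r = [:- a, 1:] ^ k * s" using poly_eq_poly_eq_iff by blast
  then have "[:- a, 1:] ^ k dvd smult (\<mu> ^ d) r" by simp
  then show ?thesis using assms(5) by (simp add: dvd_smult_iff)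
qed


section \<open>Splitting off a rational curve\<close>

lemma subspace_vanishes: "fun_vs.subspace {F. vanishes_to_order k q F}"
proof -
  have "vanishes_to_order k q (F + G)" if "vanishes_to_order k q F" "vanishes_to_order k q G" for F G
    using order_ge_add[OF that[unfolded vanishes_iff_order_ge]]
    by (simp add: vanishes_iff_order_ge)
  moreover have "vanishes_to_order k q (fscale c F)" if "vanishes_to_order k q F" for c F
    using fun_vs.subspace_scale[OF subspace_order_ge that[unfolded vanishes_iff_order_ge], of c]
    by (simp add: vanishes_iff_order_ge fscale_def)
  moreover have "vanishes_to_order k q 0"
    using fun_vs.subspace_0[OF subspace_order_ge, of k]
    by (simp add: vanishes_iff_order_ge zero_fun_def)
  ultimately show ?thesis by (simp only: fun_vs.subspace_def mem_Collect_eq) blast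
qed

lemma linsys_eq_Int:
  fixes p :: "nat \<Rightarrow> complex^'n::finite"
  shows "linsys p d m
    = forms d \<inter> \<Inter> ((\<lambda>i. {F. vanishes_to_order (m i) (p i) F}) ` {1..proj_dim TYPE('n) + 3})"
  unfolding linsys_def by blast

lemma subspace_linsys: "fun_vs.subspace (linsys p d m)"
  unfolding linsys_eq_Int
  by (intro fun_vs.subspace_inter subspace_forms fun_vs.subspace_Inter) (auto intro: subspace_vanishes)

lemma linsys_fin_gen: "linsys p d m \<subseteq> fun_vs.span (monomial ` {a. sum a UNIV = d})"
  by (rule subset_trans[OF _ forms_fin_gen]) (auto simp: linsys_def)

lemma linsys_dim_mono:
  "U \<subseteq> linsys p d m \<Longrightarrow> fun_vs.dim U \<le> linsys_dim p d m"
  unfolding linsys_dim_def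
  by (rule dim_le_of_subset_span[OF subset_trans[OF _ fun_vs.span_superset] linsys_fin_gen
        finite_imageI[OF finite_exponents]])

text \<open>The multiplicities of \<open>D - E\<close> for a curve \<open>E\<close> with simple points at \<open>I\<close>. The truncation at 0
  is harmless: multiplicity at least \<open>- 1\<close> and multiplicity at least 0 are both no condition, and
  \<open>m + 1\<close> over 2 vanishes for \<open>m = - 1\<close> as well as for \<open>m = 0\<close>.\<close>

definition reduce_on :: "nat set \<Rightarrow> (nat \<Rightarrow> nat) \<Rightarrow> nat \<Rightarrow> nat" where
  "reduce_on I m i = (if i \<in> I then m i - 1 else m i)"

text \<open>The curve \<open>P = 0\<close> of degree \<open>e\<close> is parametrised by polynomials of degree at most \<open>e\<close>, and
  \<open>I\<close> is the set of base points on it. All points of \<open>I\<close> are simple points of the curve and lie in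
  the affine part of the parametrisation. The assumption \<open>equation\<close> says that \<open>P\<close> generates the ideal
  of the curve. The lines through two of the base points and the conic through all of them are of
  this kind.\<close>

locale rational_curve =
  fixes p :: "nat \<Rightarrow> complex^'n::finite" and P :: "complex^'n \<Rightarrow> complex" and e :: nat
    and w :: "'n \<Rightarrow> complex poly" and I :: "nat set" and s \<mu> :: "nat \<Rightarrow> complex"
  assumes P_form: "P \<in> forms e"
    and degree_w: "degree (w j) \<le> e"
    and equation: "F \<in> forms d \<Longrightarrow> \<forall>t. F (\<chi> j. poly (w j) t) = 0 \<Longrightarrow>
      F = 0 \<or> e \<le> d \<and> (\<exists>G \<in> forms (d - e). \<forall>x. F x = P x * G x)"
    and I_subset: "I \<subseteq> {1..proj_dim TYPE('n) + 3}"
    and inj_s: "inj_on s I"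
    and point: "i \<in> I \<Longrightarrow> p i = \<mu> i *s (\<chi> j. poly (w j) (s i))"
    and scalar_nz: "i \<in> I \<Longrightarrow> \<mu> i \<noteq> 0"
    and simple_point: "i \<in> I \<Longrightarrow>
      \<exists>L \<in> forms 1. (\<exists>x. L x \<noteq> 0) \<and> (\<exists>R \<in> order_ge 2. \<forall>x. P (p i + x) = L x + R x)"
    and off_curve: "i \<in> {1..proj_dim TYPE('n) + 3} - I \<Longrightarrow> P (p i) \<noteq> 0"
begin

lemma finite_I: "finite I"
  using I_subset by (rule finite_subset) simp

lemma P_not_zero: "i \<in> {1..proj_dim TYPE('n) + 3} \<Longrightarrow> \<exists>x. P x \<noteq> 0"
proof (cases "i \<in> I")
  case True
  then obtain L R where LR: "L \<in> forms 1" "\<exists>x. L x \<noteq> 0" "R \<in> order_ge 2"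
    "\<forall>x. P (p i + x) = L x + R x" using simple_point by blast
  show ?thesis
  proof (rule ccontr)
    assume "\<not> ?thesis"
    then have "L x + R x = 0" for x using LR(4) by metis
    then have "L x = 0 - R x" for x by (simp add: eq_neg_iff_add_eq_0)
    then have "L = (\<lambda>x. 0 - R x)" by blast
    moreover have "(\<lambda>x. 0 - R x) \<in> order_ge 2"
      by (rule order_ge_diff[OF fun_vs.subspace_0[OF subspace_order_ge, unfolded zero_fun_def] LR(3)])
    ultimately have "L \<in> order_ge (Suc 1)" by (simp add: numeral_2_eq_2)
    then show False using forms_order_ge_Suc_eq_0[OF LR(1)] LR(2) by blast
  qed
qed (use off_curve in blast)

lemma P_translate: "(\<lambda>x. P (q + x)) \<in> order_ge 0"
  by (rule polynomial_translate[OF forms_polynomial[OF P_form]])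

lemma mult_in_linsys:
  assumes "e \<le> d" "G \<in> linsys p (d - e) (reduce_on I m)"
  shows "(\<lambda>x. P x * G x) \<in> linsys p d m"
proof -
  have G: "G \<in> forms (d - e)"
    and G_van: "\<And>i. i \<in> {1..proj_dim TYPE('n) + 3} \<Longrightarrow> (\<lambda>x. G (p i + x)) \<in> order_ge (reduce_on I m i)"
    using assms(2) by (auto simp: linsys_def vanishes_iff_order_ge)
  have "(\<lambda>x. P (p i + x) * G (p i + x)) \<in> order_ge (m i)"
    if i: "i \<in> {1..proj_dim TYPE('n) + 3}" for i
  proof (cases "i \<in> I")
    case True
    then obtain L R where LR: "L \<in> forms 1" "R \<in> order_ge 2" "\<forall>x. P (p i + x) = L x + R x"
      using simple_point by blast
    have "(\<lambda>x. L x + R x) \<in> order_ge 1"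
      using LR(1,2) forms_subset_order_ge[of 1 1] order_ge_antimono[of 1 2]
      by (intro order_ge_add) auto
    then have "(\<lambda>x. P (p i + x)) \<in> order_ge 1" using LR(3) by simp
    from order_ge_mult[OF this G_van[OF i]]
    have "(\<lambda>x. P (p i + x) * G (p i + x)) \<in> order_ge (1 + (m i - 1))"
      using True by (simp add: reduce_on_def)
    moreover have "m i \<le> 1 + (m i - 1)" by simp
    ultimately show ?thesis using order_ge_antimono by blast
  next
    case False
    then show ?thesis
      using order_ge_mult[OF P_translate G_van[OF i], of "p i"] by (simp add: reduce_on_def)
  qed
  moreover have "(\<lambda>x. P x * G x) \<in> forms d"
    using forms_mult[OF P_form G] assms(1) by simp
  ultimately show ?thesis by (simp add: linsys_def vanishes_iff_order_ge)
qed

text \<open>Division by \<open>P\<close> lowers the order by one at the points on the curve, where \<open>P\<close> has a nonzero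
  linear part, and keeps it at the other base points, where \<open>P\<close> is a unit.\<close>

lemma divide_linsys:
  assumes "F \<in> linsys p d m" "\<forall>t. F (\<chi> j. poly (w j) t) = 0"
  shows "F = 0 \<or> e \<le> d \<and> (\<exists>G \<in> linsys p (d - e) (reduce_on I m). F = P * G)"
proof (cases "F = 0")
  case False
  have F: "F \<in> forms d"
    and F_van: "\<And>i. i \<in> {1..proj_dim TYPE('n) + 3} \<Longrightarrow> (\<lambda>x. F (p i + x)) \<in> order_ge (m i)"
    using assms(1) by (auto simp: linsys_def vanishes_iff_order_ge)
  obtain G where G: "e \<le> d" "G \<in> forms (d - e)" "\<forall>x. F x = P x * G x"
    using equation[OF F assms(2)] False by blast
  have "(\<lambda>x. G (p i + x)) \<in> order_ge (reduce_on I m i)"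
    if i: "i \<in> {1..proj_dim TYPE('n) + 3}" for i
  proof -
    have G_poly: "(\<lambda>x. G (p i + x)) \<in> order_ge 0"
      by (rule polynomial_translate[OF forms_polynomial[OF G(2)]])
    have PG: "(\<lambda>x. P (p i + x) * G (p i + x)) \<in> order_ge (m i)"
      using F_van[OF i] G(3) by simp
    show ?thesis
    proof (cases "i \<in> I")
      case True
      show ?thesis
      proof (cases "m i")
        case 0
        then show ?thesis using G_poly True by (simp add: reduce_on_def)
      next
        case (Suc k)
        obtain L R x0 where LR: "L \<in> forms 1" "L x0 \<noteq> 0" "R \<in> order_ge (Suc 1)"
          "\<And>x. P (p i + x) = L x + R x"
          using simple_point[OF True] by (metis Suc_1)
        have "(\<lambda>x. G (p i + x)) \<in> order_ge k"
          using order_ge_cancel[OF LR G_poly, of k] PG Suc by simp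
        then show ?thesis using True Suc by (simp add: reduce_on_def)
      qed
    next
      case False
      then have "P (p i + 0) \<noteq> 0" using off_curve i by simp
      then show ?thesis
        using order_ge_cancel_unit[OF P_translate _ G_poly PG] False by (simp add: reduce_on_def)
    qed
  qed
  then have "G \<in> linsys p (d - e) (reduce_on I m)"
    using G(2) by (simp add: linsys_def vanishes_iff_order_ge)
  moreover have "F = P * G" using G(3) by (simp add: fun_eq_iff)
  ultimately show ?thesis using G(1) by blast
qed simp

text \<open>Bezout's theorem for the parametrised curve: the restriction of \<open>F\<close> is a polynomial of degree
  at most \<open>e d\<close> with a root of order at least \<open>m i\<close> at each \<open>s i\<close>.\<close>

lemma vanishes_on_curve:
  assumes "F \<in> linsys p d m" "finite X" "X \<inter> s ` I = {}"
    and "\<And>t. t \<in> X \<Longrightarrow> F (\<chi> j. poly (w j) t) = 0"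
    and "e * d < sum m I + card X"
  shows "F (\<chi> j. poly (w j) t) = 0"
proof -
  have F: "F \<in> forms d"
    and F_van: "\<And>i. i \<in> I \<Longrightarrow> vanishes_to_order (m i) (p i) F"
    using assms(1) I_subset by (auto simp: linsys_def)
  from forms_restrict[OF F, of w e, OF degree_w] obtain r
    where r: "degree r \<le> e * d" "\<And>t. F (\<chi> j. poly (w j) t) = poly r t"
    by metis
  have "r = 0"
  proof (rule poly_eq_0_of_many_roots[OF finite_I inj_s _ assms(2,3), of m])
    show "[:- s i, 1:] ^ m i dvd r" if "i \<in> I" for i
      using order_restrict_to_curve[OF F F_van[OF that] r(2) point[OF that] scalar_nz[OF that]] .
    show "poly r x = 0" if "x \<in> X" for x
      using assms(4)[OF that] by (simp only: r(2))
    show "degree r < sum m I + card X" using r(1) assms(5) by (rule le_less_trans)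
  qed
  then show ?thesis by (simp only: r(2) poly_0)
qed

lemma reduced_image_subset:
  "e \<le> d \<Longrightarrow> (\<lambda>G. P * G) ` linsys p (d - e) (reduce_on I m) \<subseteq> linsys p d m"
  using mult_in_linsys by (auto simp: times_fun_def)

text \<open>The kernel of the restriction to the curve is the residual system. By Bezout's theorem, the
  restriction is determined by its values at \<open>e d + 1 - \<Sum> m i\<close> further points, which is \<open>D.E + 1\<close> of
  them.\<close>

lemma linsys_dim_le_reduced:
  assumes "e \<le> d"
  shows "linsys_dim p d m \<le> linsys_dim p (d - e) (reduce_on I m) + (e * d + 1 - sum m I)"
proof -
  let ?c = "\<lambda>t. \<chi> j. poly (w j) t" and ?N = "e * d + 1 - sum m I"
  have "infinite (UNIV - s ` I)"
    using finite_I infinite_UNIV_char_0[where 'a = complex] by (intro Diff_infinite_finite) auto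
  then obtain X where X: "X \<subseteq> UNIV - s ` I" "finite X" "card X = ?N"
    using infinite_arbitrarily_large by metis
  have "linsys_dim p d m
      \<le> fun_vs.dim {F \<in> linsys p d m. \<forall>x\<in>?c ` X. F x = 0} + card (?c ` X)"
    unfolding linsys_dim_def
    by (rule dim_le_dim_vanishing_plus_card[OF subspace_linsys linsys_fin_gen
          finite_imageI[OF finite_exponents] finite_imageI[OF X(2)]])
  also have "card (?c ` X) \<le> ?N" using card_image_le[OF X(2)] X(3) by metis
  also have "fun_vs.dim {F \<in> linsys p d m. \<forall>x\<in>?c ` X. F x = 0}
      \<le> fun_vs.dim ((\<lambda>G. P * G) ` linsys p (d - e) (reduce_on I m))"
  proof (rule dim_le_of_subset_span)
    show "{F \<in> linsys p d m. \<forall>x\<in>?c ` X. F x = 0}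
        \<subseteq> fun_vs.span ((\<lambda>G. P * G) ` linsys p (d - e) (reduce_on I m))"
    proof
      fix F assume F: "F \<in> {F \<in> linsys p d m. \<forall>x\<in>?c ` X. F x = 0}"
      have "F (?c t) = 0" for t
      proof (rule vanishes_on_curve[OF _ X(2)])
        show "F \<in> linsys p d m" using F by simp
        show "X \<inter> s ` I = {}" using X(1) by blast
        show "F (?c t) = 0" if "t \<in> X" for t using F that by simp
        show "e * d < sum m I + card X" using X(3) by simp
      qed
      then have "F = 0 \<or> (\<exists>G \<in> linsys p (d - e) (reduce_on I m). F = P * G)"
        using divide_linsys[of F d m] F by blast
      then show "F \<in> fun_vs.span ((\<lambda>G. P * G) ` linsys p (d - e) (reduce_on I m))"
      proof
        assume "F = 0"
        then show ?thesis by (simp only: fun_vs.span_zero)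
      next
        assume "\<exists>G \<in> linsys p (d - e) (reduce_on I m). F = P * G"
        then obtain G where "G \<in> linsys p (d - e) (reduce_on I m)" "F = P * G" by blast
        then show ?thesis by (metis fun_vs.span_base imageI)
      qed
    qed
    show "(\<lambda>G. P * G) ` linsys p (d - e) (reduce_on I m)
        \<subseteq> fun_vs.span (monomial ` {a. sum a UNIV = d})"
      by (rule subset_trans[OF reduced_image_subset[OF assms] linsys_fin_gen])
  qed (rule finite_imageI[OF finite_exponents])
  also have "fun_vs.dim ((\<lambda>G. P * G) ` linsys p (d - e) (reduce_on I m))
      \<le> linsys_dim p (d - e) (reduce_on I m)"
    unfolding linsys_dim_def
    by (rule dim_image_mult_le[OF linsys_fin_gen finite_imageI[OF finite_exponents]])
  finally show ?thesis by simp
qed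

lemma fixed_curve_vanishes:
  assumes "F \<in> linsys p d m" "e * d < sum m I"
  shows "F (\<chi> j. poly (w j) t) = 0"
  by (rule vanishes_on_curve[OF assms(1), of "{}"]) (use assms(2) in auto)

lemma fixed_curve_divides:
  assumes "F \<in> linsys p d m" "F \<noteq> 0" "e * d < sum m I"
  obtains G where "e \<le> d" "G \<in> linsys p (d - e) (reduce_on I m)" "F = P * G"
  using divide_linsys[OF assms(1)] fixed_curve_vanishes[OF assms(1,3)] assms(2) by blast

lemma fixed_curve_residual:
  assumes "linsys p d m \<noteq> {0}" "e * d < sum m I"
  shows "e \<le> d" "linsys p (d - e) (reduce_on I m) \<noteq> {0}"
proof -
  obtain F where F: "F \<in> linsys p d m" "F \<noteq> 0"
    using assms(1) fun_vs.subspace_0[OF subspace_linsys, of p d m] by blast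
  obtain G where G: "e \<le> d" "G \<in> linsys p (d - e) (reduce_on I m)" "F = P * G"
    by (rule fixed_curve_divides[OF F assms(2)])
  show "e \<le> d" by (rule G(1))
  have "G \<noteq> 0" using F(2) G(3) by (metis mult_zero_right)
  then show "linsys p (d - e) (reduce_on I m) \<noteq> {0}" using G(2) by blast
qed

text \<open>The curve is a fixed component, so multiplication by \<open>P\<close> maps the residual system
  isomorphically onto the system.\<close>

lemma fixed_curve_dim:
  assumes "linsys p d m \<noteq> {0}" "e * d < sum m I"
  shows "linsys_dim p d m = linsys_dim p (d - e) (reduce_on I m)"
proof (rule antisym)
  note ed = fixed_curve_residual(1)[OF assms]
  show "linsys_dim p d m \<le> linsys_dim p (d - e) (reduce_on I m)"
    using linsys_dim_le_reduced[OF ed, of m] assms(2) by simp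
  have img: "(\<lambda>G. P * G) ` linsys p (d - e) (reduce_on I m) \<subseteq> linsys p d m"
    by (rule reduced_image_subset[OF ed])
  obtain x0 where x0: "P x0 \<noteq> 0" using P_not_zero[of 1] by auto
  have "linsys_dim p (d - e) (reduce_on I m)
      \<le> fun_vs.dim ((\<lambda>G. P * G) ` linsys p (d - e) (reduce_on I m))"
    unfolding linsys_dim_def
  proof (rule dim_image_mult_ge[OF linsys_fin_gen finite_imageI[OF finite_exponents] subspace_linsys])
    fix G assume G: "G \<in> linsys p (d - e) (reduce_on I m)" "P * G = 0"
    have "P x * G x = 0" for x using fun_cong[OF G(2), of x] by simp
    moreover have "G \<in> order_ge 0" using G(1) by (auto simp: linsys_def intro: forms_polynomial)
    ultimately show "G = 0" using polynomial_mult_eq_0[OF forms_polynomial[OF P_form] _ _ x0] by blast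
  next
    show "(\<lambda>G. P * G) ` linsys p (d - e) (reduce_on I m)
        \<subseteq> fun_vs.span (monomial ` {a. sum a UNIV = d})"
      by (rule subset_trans[OF img linsys_fin_gen])
  qed (rule finite_imageI[OF finite_exponents])
  also have "\<dots> \<le> linsys_dim p d m" by (rule linsys_dim_mono[OF img])
  finally show "linsys_dim p (d - e) (reduce_on I m) \<le> linsys_dim p d m" .
qed

end


section \<open>The lines and the conic through the base points\<close>

lemma proj_dim_3: "proj_dim TYPE(3) = 2"
  by (simp add: proj_dim_def)

text \<open>Forms of degree \<open>d - e\<close>, where there are no nonzero forms of negative degree.\<close>

definition residual_forms :: "nat \<Rightarrow> nat \<Rightarrow> (complex^'n::finite \<Rightarrow> complex) set" where
  "residual_forms d e = (if e \<le> d then forms (d - e) else {0})"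

lemma subspace_residual_forms: "fun_vs.subspace (residual_forms d e)"
  by (simp add: residual_forms_def subspace_forms)

lemma residual_forms_polynomial: "F \<in> residual_forms d e \<Longrightarrow> F \<in> order_ge 0"
  by (auto simp: residual_forms_def forms_polynomial fun_vs.subspace_0[OF subspace_order_ge]
      split: if_splits)

lemma residual_forms_homogeneous: "F \<in> residual_forms d e \<Longrightarrow> F (c *s x) = c ^ (d - e) * F x"
  by (auto simp: residual_forms_def forms_homogeneous split: if_splits)

lemma basis_matrix:
  fixes b :: "'n::finite \<Rightarrow> complex^'n"
  assumes "\<And>c. (\<Sum>i\<in>UNIV. c i *s b i) = 0 \<Longrightarrow> \<forall>i. c i = 0"
  obtains A B :: "complex^'n^'n" where "\<And>x. A *v (B *v x) = x" "\<And>x. B *v (A *v x) = x"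
    "\<And>x. A *v x = (\<Sum>i\<in>UNIV. x $ i *s b i)"
proof -
  define A :: "complex^'n^'n" where "A = (\<chi> r c. b c $ r)"
  have col: "column i A = b i" for i by (simp add: A_def column_def vec_eq_iff)
  have "\<exists>B. B ** A = mat 1"
    unfolding matrix_left_invertible_independent_columns col using assms by blast
  then obtain B where BA: "B ** A = mat 1" by blast
  then have AB: "A ** B = mat 1" by (simp add: matrix_left_right_inverse)
  have "A *v x = (\<Sum>i\<in>UNIV. x $ i *s b i)" for x
    unfolding matrix_mult_sum col ..
  moreover have "A *v (B *v x) = x" "B *v (A *v x) = x" for x
    by (simp_all add: matrix_vector_mul_assoc AB BA)
  ultimately show ?thesis using that by blast
qed

lemma basis_matrix_3:
  fixes b1 b2 b3 :: "complex^3"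
  assumes "\<And>x y z. x *s b1 + y *s b2 + z *s b3 = 0 \<Longrightarrow> x = 0 \<and> y = 0 \<and> z = 0"
  obtains A B :: "complex^3^3" where "\<And>x. A *v (B *v x) = x" "\<And>x. B *v (A *v x) = x"
    "\<And>x. A *v x = x $ 1 *s b1 + x $ 2 *s b2 + x $ 3 *s b3"
proof -
  define b :: "3 \<Rightarrow> complex^3" where "b = (\<lambda>i. if i = 1 then b1 else if i = 2 then b2 else b3)"
  have b: "b 1 = b1" "b 2 = b2" "b 3 = b3" by (simp_all add: b_def)
  have "\<forall>i. c i = 0" if "(\<Sum>i\<in>UNIV. c i *s b i) = 0" for c
    using assms[of "c 1" "c 2" "c 3"] that by (simp add: sum_3 b forall_3)
  then obtain A B :: "complex^3^3" where AB: "\<And>x. A *v (B *v x) = x" "\<And>x. B *v (A *v x) = x"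
    "\<And>x. A *v x = (\<Sum>i\<in>UNIV. x $ i *s b i)"
    by (rule basis_matrix[of b]) blast+
  show ?thesis by (rule that[OF AB(1,2)]) (simp add: AB(3) sum_3 b)
qed

lemma general_position_independent:
  fixes p :: "nat \<Rightarrow> complex^3"
  assumes "general_position p" "i \<in> {1..5}" "j \<in> {1..5}" "k \<in> {1..5}"
    and "i \<noteq> j" "i \<noteq> k" "j \<noteq> k"
    and "x *s p i + y *s p j + z *s p k = 0"
  shows "x = 0 \<and> y = 0 \<and> z = 0"
proof -
  have "inj_on p {i, j, k} \<and> vec.independent (p ` {i, j, k})"
    using assms(1)[unfolded general_position_def proj_dim_3, rule_format, of "{i, j, k}"] assms(2-7)
    by auto
  then have inj: "p i \<noteq> p j" "p i \<noteq> p k" "p j \<noteq> p k"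
    and ind: "vec.independent {p i, p j, p k}"
    using assms(5-7) by (auto simp: inj_on_def)
  define u where "u = (\<lambda>v. if v = p i then x else if v = p j then y else z)"
  have u: "u (p i) = x" "u (p j) = y" "u (p k) = z" using inj by (auto simp: u_def)
  have "(\<Sum>v\<in>{p i, p j, p k}. u v *s v) = 0"
    using inj assms(8) by (simp add: u add.assoc)
  then have "\<forall>v\<in>{p i, p j, p k}. u v = 0"
    using ind vec.dependent_finite[of "{p i, p j, p k}"] by auto
  then show ?thesis using u by auto
qed

lemma index_outside:
  assumes "card J < 5" "finite J"
  obtains k where "k \<in> {1..5::nat}" "k \<notin> J"
proof -
  have "\<not> {1..5} \<subseteq> J" using card_mono[OF assms(2), of "{1..5}"] assms(1) by auto
  then show ?thesis using that by blast
qed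

lemma monomial_3: "monomial a x = x $ 1 ^ a 1 * x $ 2 ^ a 2 * x $ 3 ^ a (3 :: 3)"
  unfolding monomial_def UNIV_3 by (simp add: mult.assoc)

text \<open>The remainder of the division by the third coordinate depends on the first two only.\<close>

lemma forms_split_coordinate:
  fixes F :: "complex^3 \<Rightarrow> complex"
  assumes "F \<in> forms d"
  shows "\<exists>H \<in> forms d. \<exists>G \<in> residual_forms d 1.
    (\<forall>x. H x = H (vector [x $ 1, x $ 2, 0])) \<and> (\<forall>x. F x = H x + x $ 3 * G x)"
  using assms unfolding forms_def
proof (induction rule: fun_vs.span_induct_alt)
  case base
  show ?case
    by (rule bexI[OF _ fun_vs.span_zero], rule bexI[OF _ fun_vs.subspace_0[OF subspace_residual_forms]])
      simp
next
  case (step c m F)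
  then obtain H G where HG: "H \<in> forms d" "G \<in> residual_forms d 1"
    "\<forall>x. H x = H (vector [x $ 1, x $ 2, 0])" "\<forall>x. F x = H x + x $ 3 * G x"
    unfolding forms_def by blast
  obtain a where a: "m = monomial a" "sum a UNIV = d" using step(1) by blast
  have "\<exists>H' \<in> forms d. \<exists>G' \<in> residual_forms d 1.
    (\<forall>x. H' x = H' (vector [x $ 1, x $ 2, 0])) \<and> (\<forall>x. m x = H' x + x $ 3 * G' x)"
  proof (cases "a 3")
    case 0
    then show ?thesis
      by (intro bexI[of _ m] bexI[OF _ fun_vs.subspace_0[OF subspace_residual_forms]])
        (auto simp: a monomial_3 intro: monomial_in_forms)
  next
    case (Suc n)
    have "monomial (a(3 := n)) \<in> residual_forms d 1"
      using a(2) Suc by (auto simp: residual_forms_def sum_3 intro!: monomial_in_forms)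
    then show ?thesis
      by (intro bexI[OF _ fun_vs.subspace_0[OF subspace_forms]] bexI[of _ "monomial (a(3 := n))"])
        (auto simp: a monomial_3 Suc)
  qed
  then obtain H' G' where HG': "H' \<in> forms d" "G' \<in> residual_forms d 1"
    "\<forall>x. H' x = H' (vector [x $ 1, x $ 2, 0])" "\<forall>x. m x = H' x + x $ 3 * G' x"
    by blast
  have "fscale c H' + H \<in> forms d"
    using HG HG' by (intro fun_vs.subspace_add fun_vs.subspace_scale subspace_forms)
  moreover have "fscale c G' + G \<in> residual_forms d 1"
    using HG HG' by (intro fun_vs.subspace_add fun_vs.subspace_scale subspace_residual_forms)
  moreover have "(fscale c H' + H) x = (fscale c H' + H) (vector [x $ 1, x $ 2, 0])" for x
    unfolding plus_fun_apply fscale_def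
    by (subst HG(3)[rule_format], subst HG'(3)[rule_format], rule refl)
  moreover have "(fscale c m + F) x = (fscale c H' + H) x + x $ 3 * (fscale c G' + G) x" for x
    unfolding plus_fun_apply fscale_def HG'(4)[rule_format] HG(4)[rule_format]
    by (simp add: algebra_simps)
  ultimately show ?case unfolding forms_def by blast
qed

definition conic_form :: "complex^3 \<Rightarrow> complex" where
  "conic_form x = x $ 1 * x $ 3 - (x $ 2)\<^sup>2"

text \<open>\<open>H\<close> and \<open>K\<close> are polynomials in \<open>x\<^sub>1\<close> and \<open>x\<^sub>3\<close> only.\<close>

definition conic_reducible :: "nat \<Rightarrow> (complex^3 \<Rightarrow> complex) \<Rightarrow> bool" where
  "conic_reducible d F \<longleftrightarrow> (\<exists>H \<in> forms d. \<exists>K \<in> residual_forms d 1. \<exists>G \<in> residual_forms d 2.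
    (\<forall>x. H x = H (vector [x $ 1, 0, x $ 3])) \<and> (\<forall>x. K x = K (vector [x $ 1, 0, x $ 3])) \<and>
    (\<forall>x. F x = H x + x $ 2 * K x + conic_form x * G x))"

lemma conic_reducible_zero: "conic_reducible d 0"
  unfolding conic_reducible_def
  by (intro bexI[OF _ fun_vs.subspace_0[OF subspace_forms]]
      bexI[OF _ fun_vs.subspace_0[OF subspace_residual_forms]]) simp

lemma conic_reducible_add:
  assumes "conic_reducible d F" "conic_reducible d F'"
  shows "conic_reducible d (fscale c F + F')"
proof -
  obtain H K G where 1: "H \<in> forms d" "K \<in> residual_forms d 1" "G \<in> residual_forms d 2"
    "\<forall>x. H x = H (vector [x $ 1, 0, x $ 3])" "\<forall>x. K x = K (vector [x $ 1, 0, x $ 3])"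
    "\<forall>x. F x = H x + x $ 2 * K x + conic_form x * G x"
    using assms(1) unfolding conic_reducible_def by blast
  obtain H' K' G' where 2: "H' \<in> forms d" "K' \<in> residual_forms d 1" "G' \<in> residual_forms d 2"
    "\<forall>x. H' x = H' (vector [x $ 1, 0, x $ 3])" "\<forall>x. K' x = K' (vector [x $ 1, 0, x $ 3])"
    "\<forall>x. F' x = H' x + x $ 2 * K' x + conic_form x * G' x"
    using assms(2) unfolding conic_reducible_def by blast
  have "fscale c H + H' \<in> forms d"
    using 1 2 by (intro fun_vs.subspace_add fun_vs.subspace_scale subspace_forms)
  moreover have "fscale c K + K' \<in> residual_forms d 1"
    using 1 2 by (intro fun_vs.subspace_add fun_vs.subspace_scale subspace_residual_forms)
  moreover have "fscale c G + G' \<in> residual_forms d 2"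
    using 1 2 by (intro fun_vs.subspace_add fun_vs.subspace_scale subspace_residual_forms)
  moreover have "(fscale c H + H') x = (fscale c H + H') (vector [x $ 1, 0, x $ 3])" for x
    unfolding plus_fun_apply fscale_def
    by (subst 1(4)[rule_format], subst 2(4)[rule_format], rule refl)
  moreover have "(fscale c K + K') x = (fscale c K + K') (vector [x $ 1, 0, x $ 3])" for x
    unfolding plus_fun_apply fscale_def
    by (subst 1(5)[rule_format], subst 2(5)[rule_format], rule refl)
  moreover have "(fscale c F + F') x = (fscale c H + H') x + x $ 2 * (fscale c K + K') x
      + conic_form x * (fscale c G + G') x" for x
    unfolding plus_fun_apply fscale_def 1(6)[rule_format] 2(6)[rule_format]
    by (simp add: algebra_simps)
  ultimately show ?thesis unfolding conic_reducible_def by blast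
qed

text \<open>Replacing \<open>x\<^sub>2\<^sup>2\<close> by \<open>x\<^sub>1 x\<^sub>3\<close> repeatedly makes every monomial at most linear in \<open>x\<^sub>2\<close>, modulo the
  equation of the conic.\<close>

lemma conic_reducible_monomial:
  "sum a UNIV = d \<Longrightarrow> conic_reducible d (monomial a)"
proof (induction "a 2" arbitrary: a rule: less_induct)
  case less
  note deg = less.prems[unfolded sum_3]
  consider "a 2 = 0" | "a 2 = 1" | n where "a 2 = Suc (Suc n)"
    by (metis One_nat_def not0_implies_Suc)
  then show ?case
  proof cases
    case 1
    then show ?thesis
      unfolding conic_reducible_def
      by (intro bexI[of _ "monomial a"] bexI[OF _ fun_vs.subspace_0[OF subspace_residual_forms]])
        (auto simp: monomial_3 intro: monomial_in_forms less.prems)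
  next
    case 2
    have "monomial (a(2 := 0)) \<in> residual_forms d 1"
      using deg 2 by (auto simp: residual_forms_def sum_3 intro!: monomial_in_forms)
    then show ?thesis
      unfolding conic_reducible_def
      by (intro bexI[OF _ fun_vs.subspace_0[OF subspace_forms]] bexI[of _ "monomial (a(2 := 0))"]
          bexI[OF _ fun_vs.subspace_0[OF subspace_residual_forms]])
        (auto simp: monomial_3 2)
  next
    case 3
    define a' where "a' = a(1 := a 1 + 1, 2 := n, 3 := a 3 + 1)"
    have "conic_reducible d (monomial a')"
      by (rule less.hyps) (use deg 3 in \<open>auto simp: a'_def sum_3\<close>)
    moreover have "conic_reducible d (\<lambda>x. conic_form x * monomial (a(2 := n)) x)"
    proof -
      have "monomial (a(2 := n)) \<in> residual_forms d 2"
        using deg 3 by (auto simp: residual_forms_def sum_3 intro!: monomial_in_forms)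
      then show ?thesis
        unfolding conic_reducible_def
        by (intro bexI[OF _ fun_vs.subspace_0[OF subspace_forms]]
          bexI[OF _ fun_vs.subspace_0[OF subspace_residual_forms]] bexI[of _ "monomial (a(2 := n))"])
          auto
    qed
    ultimately have "conic_reducible d
        (fscale (- 1) (\<lambda>x. conic_form x * monomial (a(2 := n)) x) + monomial a')"
      by (rule conic_reducible_add[rotated])
    moreover have "fscale (- 1) (\<lambda>x. conic_form x * monomial (a(2 := n)) x) + monomial a'
        = monomial a"
      by (simp add: fun_eq_iff fscale_def monomial_3 conic_form_def a'_def 3 algebra_simps
          power2_eq_square)
    ultimately show ?thesis by simp
  qed
qed

lemma forms_conic_reducible:
  assumes "F \<in> forms d" shows "conic_reducible d F"
  using assms unfolding forms_def
proof (induction rule: fun_vs.span_induct_alt)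
  case base
  show ?case by (rule conic_reducible_zero)
next
  case (step c m F)
  then show ?case using conic_reducible_monomial by (intro conic_reducible_add) auto
qed

lemma conic_form_in_forms: "conic_form \<in> forms 2"
proof -
  have "(\<lambda>x :: complex^3. x $ 1 * x $ 3 + (- 1) * (x $ 2 * x $ 2)) \<in> forms (1 + 1)"
    by (intro forms_add forms_scale forms_mult coordinate_in_forms)
  moreover have "(\<lambda>x. x $ 1 * x $ 3 + (- 1) * (x $ 2 * x $ 2)) = conic_form"
    by (simp add: fun_eq_iff conic_form_def power2_eq_square)
  ultimately show ?thesis by (simp add: numeral_2_eq_2)
qed

text \<open>The remainder \<open>H + x\<^sub>2 K\<close> of a form that vanishes on the conic is zero: restricted to
  \<open>(1, t, t\<^sup>2)\<close>, the two summands are the even and the odd part in \<open>t\<close>, so both vanish, and by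
  homogeneity \<open>H\<close> and \<open>K\<close> vanish wherever \<open>x\<^sub>1 x\<^sub>3\<close> does not.\<close>

lemma vanishing_on_conic:
  assumes F: "F \<in> forms d" and van: "\<And>t. F (vector [1, t, t\<^sup>2]) = 0"
  shows "\<exists>G \<in> residual_forms d 2. \<forall>x. F x = conic_form x * G x"
proof -
  obtain H K G where 1: "H \<in> forms d" "K \<in> residual_forms d 1" "G \<in> residual_forms d 2"
    "\<forall>x. H x = H (vector [x $ 1, 0, x $ 3])" "\<forall>x. K x = K (vector [x $ 1, 0, x $ 3])"
    "\<forall>x. F x = H x + x $ 2 * K x + conic_form x * G x"
    using forms_conic_reducible[OF F] unfolding conic_reducible_def by blast
  have ind: "H (vector [a, t, b]) = H (vector [a, 0, b])"
    "K (vector [a, t, b]) = K (vector [a, 0, b])" for a b t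
    using 1(4)[rule_format, of "vector [a, t, b]"] 1(5)[rule_format, of "vector [a, t, b]"] by simp_all
  have "H (vector [1, 0, t\<^sup>2]) + t * K (vector [1, 0, t\<^sup>2]) = 0" for t
    using van[of t] 1(6)[rule_format, of "vector [1, t, t\<^sup>2]"]
    by (simp add: ind[of 1 t] conic_form_def)
  from this this[of "- t" for t]
  have HK: "H (vector [1, 0, t\<^sup>2]) + t * K (vector [1, 0, t\<^sup>2]) = 0"
    "H (vector [1, 0, t\<^sup>2]) - t * K (vector [1, 0, t\<^sup>2]) = 0" for t
    by simp_all
  have H0: "H (vector [1, 0, t\<^sup>2]) = 0" for t
  proof -
    have "2 * H (vector [1, 0, t\<^sup>2]) = 0" using HK[of t] by (simp add: algebra_simps)
    then show ?thesis by simp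
  qed
  then have K0: "t * K (vector [1, 0, t\<^sup>2]) = 0" for t using HK(1)[of t] by simp
  have rescale: "(vector [x $ 1, 0, x $ 3] :: complex^3) = x $ 1 *s vector [1, 0, (csqrt (x $ 3 / x $ 1))\<^sup>2]"
    if "x $ 1 \<noteq> 0" for x :: "complex^3"
    using that by (simp add: vec_eq_iff forall_3)
  have "x $ 1 * H x = 0" for x
  proof (cases "x $ 1 = 0")
    case False
    have "H x = H (x $ 1 *s vector [1, 0, (csqrt (x $ 3 / x $ 1))\<^sup>2])"
      using 1(4) rescale[OF False] by metis
    also have "\<dots> = 0" unfolding forms_homogeneous[OF 1(1)] H0 by simp
    finally show ?thesis by simp
  qed simp
  then have "H = 0"
    using polynomial_mult_eq_0[OF forms_polynomial[OF coordinate_in_forms[of 1]]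
        forms_polynomial[OF 1(1)], of "vector [1, 0, 0]"] by simp
  have "(x $ 1 * x $ 3) * K x = 0" for x
  proof (cases "x $ 1 = 0 \<or> x $ 3 = 0")
    case False
    then have "csqrt (x $ 3 / x $ 1) \<noteq> 0" by simp
    then have K0': "K (vector [1, 0, (csqrt (x $ 3 / x $ 1))\<^sup>2]) = 0" using K0 mult_eq_0_iff by blast
    have "K x = K (x $ 1 *s vector [1, 0, (csqrt (x $ 3 / x $ 1))\<^sup>2])"
      using 1(5) rescale[of x] False by metis
    also have "\<dots> = 0" unfolding residual_forms_homogeneous[OF 1(2)] K0' by simp
    finally show ?thesis by simp
  qed auto
  then have "K = 0"
    using polynomial_mult_eq_0[OF forms_polynomial[OF forms_mult[OF
          coordinate_in_forms[of 1] coordinate_in_forms[of 3]]]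
        residual_forms_polynomial[OF 1(2)], of "vector [1, 0, 1]"] by simp
  show ?thesis using 1(3,6) by (simp add: \<open>H = 0\<close> \<open>K = 0\<close>) blast
qed


text \<open>The line is parametrised such that the two points have the parameters 0 and 1. Its equation
  is a coordinate with respect to the basis formed by these points and a third base point.\<close>

lemma line_through_points:
  fixes p :: "nat \<Rightarrow> complex^3"
  assumes gp: "general_position p" and ij: "i \<in> {1..5}" "j \<in> {1..5}" "i \<noteq> j"
  obtains P w s \<mu> where "rational_curve p P 1 w {i, j} s \<mu>"
    "\<And>x. x \<in> vec.span {p i, p j} \<Longrightarrow> P x = 0"
proof -
  have "card {i, j} < 5" by (simp add: card_insert_if)
  then obtain k where "k \<in> {1..5}" "k \<notin> {i, j}" by (rule index_outside) simp
  then have k: "k \<in> {1..5}" "k \<noteq> i" "k \<noteq> j" by auto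
  obtain A B :: "complex^3^3" where AB: "\<And>x. A *v (B *v x) = x" "\<And>x. B *v (A *v x) = x"
    "\<And>x. A *v x = x $ 1 *s p i + x $ 2 *s p j + x $ 3 *s p k"
    using basis_matrix_3[of "p i" "p j" "p k"]
      general_position_independent[OF gp ij(1,2) k(1) ij(3)] k by metis
  have A_vec: "A *v vector [a, b, c] = a *s p i + b *s p j + c *s p k" for a b c
    by (simp add: AB(3))
  have B_comb: "B *v (a *s p i + b *s p j + c *s p k) = vector [a, b, c]" for a b c
    by (simp only: AB(2) flip: A_vec)
  define P where "P = (\<lambda>x. (B *v x) $ 3)"
  define w where "w = (\<lambda>n. [:p i $ n, (p j - p i) $ n:])"
  define s where "s = (\<lambda>l. if l = i then 0 else 1 :: complex)"
  have w: "(\<chi> n. poly (w n) t) = (1 - t) *s p i + t *s p j" for t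
    by (simp add: w_def vec_eq_iff algebra_simps)
  have P_comb: "P (a *s p i + b *s p j + c *s p k) = c" for a b c
    by (simp add: P_def B_comb)
  have P_line: "P (a *s p i + b *s p j) = 0" for a b
    using P_comb[of a b 0] by simp
  have "rational_curve p P 1 w {i, j} s (\<lambda>_. 1)"
  proof
    show P: "P \<in> forms 1" unfolding P_def by (rule linear_in_forms)
    show "degree (w n) \<le> 1" for n by (simp add: w_def)
    show "F = 0 \<or> 1 \<le> d \<and> (\<exists>G \<in> forms (d - 1). \<forall>x. F x = P x * G x)"
      if F: "F \<in> forms d" "\<forall>t. F (\<chi> n. poly (w n) t) = 0" for F d
    proof -
      define F' where "F' = (\<lambda>x. F (A *v x))"
      have "F' \<in> forms d" unfolding F'_def by (rule forms_linear_substitute[OF F(1)])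
      then obtain H G where HG: "H \<in> forms d" "G \<in> residual_forms d 1"
        "\<forall>x. H x = H (vector [x $ 1, x $ 2, 0])" "\<forall>x. F' x = H x + x $ 3 * G x"
        using forms_split_coordinate by blast
      have "(x $ 1 + x $ 2) * H x = 0" for x
      proof (cases "x $ 1 + x $ 2 = 0")
        case False
        define t where "t = x $ 2 / (x $ 1 + x $ 2)"
        have t: "(x $ 1 + x $ 2) * t = x $ 2" using False by (simp add: t_def)
        have "(vector [x $ 1, x $ 2, 0] :: complex^3) = (x $ 1 + x $ 2) *s vector [1 - t, t, 0 :: complex]"
          using t by (simp add: vec_eq_iff forall_3 algebra_simps)
        then have "H x = (x $ 1 + x $ 2) ^ d * H (vector [1 - t, t, 0])"
          using HG(3) forms_homogeneous[OF HG(1)] by metis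
        also have "H (vector [1 - t, t, 0]) = F' (vector [1 - t, t, 0])"
          using HG(4) by simp
        also have "\<dots> = 0" using F(2)[rule_format, of t] by (simp add: F'_def A_vec w)
        finally show ?thesis by simp
      qed simp
      moreover have "(\<lambda>x :: complex^3. x $ 1 + x $ 2) \<in> order_ge 0"
        by (intro order_ge_add forms_polynomial[OF coordinate_in_forms])
      ultimately have "H = 0"
        using polynomial_mult_eq_0[OF _ forms_polynomial[OF HG(1)], of _ "vector [1, 0, 0]"]
        by simp
      have FG: "F x = P x * G (B *v x)" for x
        using HG(4)[rule_format, of "B *v x"] by (simp add: F'_def AB(1) \<open>H = 0\<close> P_def)
      show ?thesis
      proof (cases "1 \<le> d")
        case True
        then have "(\<lambda>x. G (B *v x)) \<in> forms (d - 1)"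
          using HG(2) by (intro forms_linear_substitute) (simp add: residual_forms_def)
        with True FG show ?thesis
          by (intro disjI2 conjI bexI[of _ "\<lambda>x. G (B *v x)"]) simp_all
      next
        case False
        then have "F = 0" using HG(2) FG by (simp add: residual_forms_def fun_eq_iff)
        then show ?thesis ..
      qed
    qed
    show "{i, j} \<subseteq> {1..proj_dim TYPE(3) + 3}" using ij by (simp add: proj_dim_3)
    show "inj_on s {i, j}" using ij(3) by (simp add: s_def)
    show "p l = 1 *s (\<chi> n. poly (w n) (s l))" if "l \<in> {i, j}" for l
      using that ij(3) unfolding w by (auto simp: s_def)
    show "\<exists>L \<in> forms 1. (\<exists>x. L x \<noteq> 0) \<and> (\<exists>R \<in> order_ge 2. \<forall>x. P (p l + x) = L x + R x)"
      if "l \<in> {i, j}" for l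
    proof (intro bexI[OF _ P] conjI)
      show "\<exists>x. P x \<noteq> 0" using P_comb[of 0 0 1] by (intro exI[of _ "p k"]) simp
      have "P (p l) = 0" using that P_line[of 1 0] P_line[of 0 1] by auto
      then have "P (p l + x) = P x + 0" for x
        by (simp add: P_def matrix_vector_right_distrib)
      then show "\<exists>R \<in> order_ge 2. \<forall>x. P (p l + x) = P x + R x"
        by (intro bexI[OF _ fun_vs.subspace_0[OF subspace_order_ge]]) simp
    qed
    show "P (p l) \<noteq> 0" if "l \<in> {1..proj_dim TYPE(3) + 3} - {i, j}" for l
    proof
      assume 0: "P (p l) = 0"
      have l: "l \<in> {1..5}" "i \<noteq> l" "j \<noteq> l" using that by (auto simp: proj_dim_3)
      have "p l = (B *v p l) $ 1 *s p i + (B *v p l) $ 2 *s p j"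
        using AB(1)[of "p l"] 0 by (simp add: AB(3) P_def)
      then have "(B *v p l) $ 1 *s p i + (B *v p l) $ 2 *s p j + (- 1) *s p l = 0"
        by (metis add.right_inverse vector_sneg_minus1)
      then show False
        using general_position_independent[OF gp ij(1,2) l(1) ij(3) l(2,3)] by fastforce
    qed
  qed simp
  moreover have "P x = 0" if x: "x \<in> vec.span {p i, p j}" for x
  proof -
    obtain a b where "x - a *s p i - b *s p j \<in> vec.span {}"
      using x unfolding vec.span_breakdown_eq by blast
    then have "x = a *s p i + b *s p j" by (simp add: algebra_simps)
    then show ?thesis by (simp only: P_line)
  qed
  ultimately show ?thesis by (rule that)
qed


text \<open>The parametrisation of the conic by pairs \<open>(u, v)\<close> is dehomogenised at a point \<open>v = \<kappa> u\<close> that is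
  different from all base points, so that these get finite parameters \<open>u / (v - \<kappa> u)\<close>. In a suitable
  basis the conic is again \<open>(1, t, t\<^sup>2)\<close>.\<close>

lemma conic_through_points:
  fixes p :: "nat \<Rightarrow> complex^3"
  assumes gp: "general_position p" and rnc: "rational_normal_curve C" and pC: "\<forall>i \<in> {1..5}. p i \<in> C"
  obtains P w s \<mu> where "rational_curve p P 2 w {1..5} s \<mu>" "\<And>x. x \<in> C \<Longrightarrow> P x = 0"
proof -
  obtain e :: "nat \<Rightarrow> complex^3" where e: "inj_on e {0..2}" "vec.independent (e ` {0..2})"
    "C = {(\<Sum>j = 0..2. (u ^ j * v ^ (2 - j)) *s e j) | u v. True}"
    using rnc unfolding rational_normal_curve_def proj_dim_3 Let_def by blast
  have sum2: "(\<Sum>j = 0..2. f j) = f 0 + f 1 + f (2::nat)" for f :: "nat \<Rightarrow> complex^3"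
    by (simp add: numeral_2_eq_2)
  have C: "x \<in> C \<longleftrightarrow> (\<exists>u v. x = v\<^sup>2 *s e 0 + (u * v) *s e 1 + u\<^sup>2 *s e 2)" for x
    unfolding e(3) sum2 by simp
  have e_ind: "x = 0 \<and> y = 0 \<and> z = 0" if "x *s e 0 + y *s e 1 + z *s e 2 = 0" for x y z
  proof -
    define f where "f = (\<lambda>n :: nat. if n = 0 then x else if n = 1 then y else z)"
    have f: "f 0 = x" "f 1 = y" "f 2 = z" by (auto simp: f_def)
    define u where "u = (\<lambda>v. f (the_inv_into {0..2} e v))"
    have "(\<Sum>v\<in>e ` {0..2}. u v *s v) = (\<Sum>n = 0..2. f n *s e n)"
      using e(1) by (subst sum.reindex) (auto simp: u_def the_inv_into_f_f intro!: sum.cong)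
    also have "\<dots> = 0" unfolding sum2 f by (rule that)
    finally have "\<forall>v\<in>e ` {0..2}. u v = 0"
      using e(2) vec.dependent_finite[of "e ` {0..2}"] by blast
    then have "f n = 0" if "n \<in> {0..2}" for n
      using that e(1) by (auto simp: u_def the_inv_into_f_f)
    then have "f 0 = 0" "f 1 = 0" "f 2 = 0" by auto
    then show ?thesis by (simp only: f)
  qed
  have "\<forall>i. \<exists>u v. i \<in> {1..5} \<longrightarrow> p i = v\<^sup>2 *s e 0 + (u * v) *s e 1 + u\<^sup>2 *s e 2"
    using pC C by blast
  then obtain u v where uv: "\<And>i. i \<in> {1..5} \<Longrightarrow> p i = (v i)\<^sup>2 *s e 0 + (u i * v i) *s e 1 + (u i)\<^sup>2 *s e 2"
    by metis
  obtain \<kappa> where \<kappa>: "\<kappa> \<notin> (\<lambda>i. v i / u i) ` {1..5::nat}"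
    using ex_new_if_finite[OF infinite_UNIV_char_0[where 'a = complex]] by blast
  have p_nz: "p i \<noteq> 0" if i: "i \<in> {1..5}" for i
  proof
    assume 0: "p i = 0"
    obtain j where "j \<in> {1..5}" "j \<notin> {i}" by (rule index_outside[of "{i}"]) auto
    moreover have "card {i, j} < 5" by (simp add: card_insert_if)
    then obtain k where "k \<in> {1..5}" "k \<notin> {i, j}" by (rule index_outside) simp
    ultimately have "j \<in> {1..5}" "k \<in> {1..5}" "i \<noteq> j" "i \<noteq> k" "j \<noteq> k" by auto
    then show False
      using general_position_independent[OF gp i, of j k 1 0 0] 0 by simp
  qed
  define lam where "lam = (\<lambda>i. v i - \<kappa> * u i)"
  have lam_nz: "lam i \<noteq> 0" if i: "i \<in> {1..5}" for i
  proof
    assume 0: "lam i = 0"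
    show False
    proof (cases "u i = 0")
      case True
      then show False using p_nz[OF i] uv[OF i] 0 by (simp add: lam_def)
    next
      case False
      then have "\<kappa> = v i / u i" using 0 by (simp add: lam_def field_simps)
      then show False using \<kappa> i by blast
    qed
  qed
  define b2 b3 where "b2 = (2 * \<kappa>) *s e 0 + e 1" and "b3 = \<kappa>\<^sup>2 *s e 0 + \<kappa> *s e 1 + e 2"
  have comb: "a *s e 0 + b *s b2 + c *s b3
      = (a + 2 * \<kappa> * b + \<kappa>\<^sup>2 * c) *s e 0 + (b + \<kappa> * c) *s e 1 + c *s e 2" for a b c
    by (simp add: b2_def b3_def vec_eq_iff algebra_simps)
  have "x = 0 \<and> y = 0 \<and> z = 0" if "x *s e 0 + y *s b2 + z *s b3 = 0" for x y z
    using e_ind[OF that[unfolded comb]] by auto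
  then obtain A B :: "complex^3^3" where AB: "\<And>x. A *v (B *v x) = x" "\<And>x. B *v (A *v x) = x"
    "\<And>x. A *v x = x $ 1 *s e 0 + x $ 2 *s b2 + x $ 3 *s b3"
    using basis_matrix_3[of "e 0" b2 b3] by metis
  have A_vec: "A *v vector [a, b, c] = a *s e 0 + b *s b2 + c *s b3" for a b c
    by (simp add: AB(3))
  have C_param: "(l + \<kappa> * y)\<^sup>2 *s e 0 + (y * (l + \<kappa> * y)) *s e 1 + y\<^sup>2 *s e 2
      = A *v vector [l\<^sup>2, l * y, y\<^sup>2]" for l y
    unfolding A_vec comb by (simp add: vec_eq_iff algebra_simps power2_eq_square)
  define P where "P = (\<lambda>x. conic_form (B *v x))"
  define w where "w = (\<lambda>n. [:e 0 $ n, b2 $ n, b3 $ n:])"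
  define s where "s = (\<lambda>i. u i / lam i)"
  define \<mu> where "\<mu> = (\<lambda>i. (lam i)\<^sup>2)"
  have w: "(\<chi> n. poly (w n) t) = A *v vector [1, t, t\<^sup>2]" for t
    unfolding A_vec by (simp add: w_def vec_eq_iff algebra_simps power2_eq_square)
  have p_eq: "p i = \<mu> i *s (A *v vector [1, s i, (s i)\<^sup>2])" if i: "i \<in> {1..5}" for i
  proof -
    have "v i = lam i + \<kappa> * u i" by (simp add: lam_def)
    then have "p i = A *v vector [(lam i)\<^sup>2, lam i * u i, (u i)\<^sup>2]"
      using uv[OF i] C_param[of "lam i" "u i"] by simp
    also have "vector [(lam i)\<^sup>2, lam i * u i, (u i)\<^sup>2] = \<mu> i *s (vector [1, s i, (s i)\<^sup>2] :: complex^3)"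
      using lam_nz[OF i]
      by (simp add: vec_eq_iff forall_3 \<mu>_def s_def power2_eq_square)
    finally show ?thesis by (simp only: vec.scale)
  qed
  have "rational_curve p P 2 w {1..5} s \<mu>"
  proof
    show P: "P \<in> forms 2" unfolding P_def by (rule forms_linear_substitute[OF conic_form_in_forms])
    show "degree (w n) \<le> 2" for n by (simp add: w_def)
    show "F = 0 \<or> 2 \<le> d \<and> (\<exists>G \<in> forms (d - 2). \<forall>x. F x = P x * G x)"
      if F: "F \<in> forms d" "\<forall>t. F (\<chi> n. poly (w n) t) = 0" for F d
    proof -
      have "F (A *v vector [1, t, t\<^sup>2]) = 0" for t using F(2) by (simp only: w)
      then obtain G where G: "G \<in> residual_forms d 2" "\<forall>x. F (A *v x) = conic_form x * G x"
        using vanishing_on_conic[OF forms_linear_substitute[OF F(1), of A]] by blast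
      have FG: "F x = P x * G (B *v x)" for x
        using G(2)[rule_format, of "B *v x"] by (simp add: AB(1) P_def)
      show ?thesis
      proof (cases "2 \<le> d")
        case True
        then have "(\<lambda>x. G (B *v x)) \<in> forms (d - 2)"
          using G(1) by (intro forms_linear_substitute) (simp add: residual_forms_def)
        with True FG show ?thesis
          by (intro disjI2 conjI bexI[of _ "\<lambda>x. G (B *v x)"]) simp_all
      next
        case False
        then have "F = 0" using G(1) FG by (simp add: residual_forms_def fun_eq_iff)
        then show ?thesis ..
      qed
    qed
    show "{1..5} \<subseteq> {1..proj_dim TYPE(3) + 3}" by (simp add: proj_dim_3)
    show "inj_on s {1..5}"
    proof (rule inj_onI, rule ccontr)
      fix i j :: nat assume ij: "i \<in> {1..5}" "j \<in> {1..5}" "s i = s j" "i \<noteq> j"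
      have "card {i, j} < 5" by (simp add: card_insert_if)
      then obtain k where "k \<in> {1..5}" "k \<notin> {i, j}" by (rule index_outside) simp
      then have k: "k \<in> {1..5}" "i \<noteq> k" "j \<noteq> k" by auto
      have "\<mu> j *s p i + (- \<mu> i) *s p j + 0 *s p k = 0"
        unfolding p_eq[OF ij(1)] p_eq[OF ij(2)] ij(3) by (simp add: vec_eq_iff)
      then show False
        using general_position_independent[OF gp ij(1,2) k(1) ij(4) k(2,3)] lam_nz[OF ij(2)]
        by (fastforce simp: \<mu>_def)
    qed
    show "p i = \<mu> i *s (\<chi> n. poly (w n) (s i))" if "i \<in> {1..5}" for i
      unfolding w by (rule p_eq[OF that])
    show "\<mu> i \<noteq> 0" if "i \<in> {1..5}" for i using lam_nz[OF that] by (simp add: \<mu>_def)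
    show "\<exists>L \<in> forms 1. (\<exists>x. L x \<noteq> 0) \<and> (\<exists>R \<in> order_ge 2. \<forall>x. P (p i + x) = L x + R x)"
      if i: "i \<in> {1..5}" for i
    proof -
      \<comment> \<open>the tangent line at \<open>\<mu> (1, s, s\<^sup>2)\<close>\<close>
      define L where "L = (\<lambda>x. \<mu> i * ((B *v x) $ 3 + ((s i)\<^sup>2 * (B *v x) $ 1 + (- 2 * s i) * (B *v x) $ 2)))"
      have "L \<in> forms 1" unfolding L_def
        by (intro forms_add forms_scale linear_in_forms)
      moreover have "L b3 \<noteq> 0"
      proof -
        have "A *v vector [0, 0, 1] = b3" by (simp add: A_vec)
        then have "B *v b3 = vector [0, 0, 1]" using AB(2) by metis
        then show ?thesis using lam_nz[OF i] by (simp add: L_def \<mu>_def)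
      qed
      moreover have "P \<in> order_ge 2" using forms_subset_order_ge[of 2 2] P by blast
      moreover have "P (p i + x) = L x + P x" for x
      proof -
        have "B *v (p i + x) = \<mu> i *s vector [1, s i, (s i)\<^sup>2] + B *v x"
          by (simp only: p_eq[OF i] matrix_vector_right_distrib AB(2) flip: vec.scale)
        then show ?thesis
          by (simp add: P_def L_def conic_form_def power2_eq_square algebra_simps)
      qed
      ultimately show ?thesis by blast
    qed
    show "P (p l) \<noteq> 0" if "l \<in> {1..proj_dim TYPE(3) + 3} - {1..5}" for l
      using that by (simp add: proj_dim_3)
  qed
  moreover have "P x = 0" if "x \<in> C" for x
  proof -
    obtain y z where x: "x = z\<^sup>2 *s e 0 + (y * z) *s e 1 + y\<^sup>2 *s e 2" using \<open>x \<in> C\<close> C by blast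
    define l where "l = z - \<kappa> * y"
    have "z = l + \<kappa> * y" by (simp add: l_def)
    then have "x = A *v vector [l\<^sup>2, l * y, y\<^sup>2]" using x C_param[of l y] by simp
    then have "B *v x = vector [l\<^sup>2, l * y, y\<^sup>2]" by (simp only: AB(2))
    then show ?thesis by (simp add: P_def conic_form_def power_mult_distrib)
  qed
  ultimately show ?thesis by (rule that)
qed


section \<open>Counting conditions\<close>

lemma card_triangle: "card (SIGMA b:{..<k}. {..<k - b}) = (k + 1) choose 2"
proof -
  have "card (SIGMA b:{..<k}. {..<k - b}) = (\<Sum>b<k. k - b)" by simp
  also have "\<dots> = (\<Sum>b<k. Suc b)"
    by (subst sum.nat_diff_reindex[symmetric]) (auto intro!: sum.cong)
  also have "\<dots> = (k + 1) choose 2"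
    by (induction k) (simp_all add: numeral_2_eq_2)
  finally show ?thesis .
qed

text \<open>The exponents of a monomial of degree \<open>d\<close> are determined by the last two.\<close>

definition exponents :: "nat \<Rightarrow> nat \<times> nat \<Rightarrow> 3 \<Rightarrow> nat" where
  "exponents d bc = (\<lambda>i. if i = 1 then d - fst bc - snd bc else if i = 2 then fst bc else snd bc)"

lemma exponents_simps [simp]:
  "exponents d bc 1 = d - fst bc - snd bc" "exponents d bc 2 = fst bc" "exponents d bc 3 = snd bc"
  by (simp_all add: exponents_def)

lemma exponents_of_degree:
  assumes "sum a UNIV = d"
  shows "a = exponents d (a 2, a 3)"
proof
  show "a i = exponents d (a 2, a 3) i" for i
    using assms exhaust_3[of i] by (auto simp: sum_3)
qed

text \<open>The monomials of degree \<open>d\<close> restrict to pairwise different powers of \<open>t\<close> on the curve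
  \<open>(1, t, t\<^bsup>d+1\<^esup>)\<close>.\<close>

lemma dim_forms_ge: "(d + 2) choose 2 \<le> fun_vs.dim (forms d :: (complex^3 \<Rightarrow> complex) set)"
proof -
  define K where "K = (SIGMA b:{..<d + 1}. {..<d + 1 - b})"
  define f :: "nat \<times> nat \<Rightarrow> complex^3 \<Rightarrow> complex" where "f = (\<lambda>bc. monomial (exponents d bc))"
  define E where "E = (\<lambda>bc :: nat \<times> nat. fst bc + (d + 1) * snd bc)"
  have fin: "finite K" by (simp add: K_def)
  have f_eval: "f bc (vector [1, t, t ^ (d + 1)]) = t ^ E bc" for bc t
    by (simp only: f_def monomial_3 exponents_simps vector_3 E_def power_add power_mult) simp
  have inj_E: "inj_on E K"
  proof (rule inj_onI)
    fix x y assume xy: "x \<in> K" "y \<in> K" "E x = E y"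
    have "fst z = E z mod (d + 1) \<and> snd z = E z div (d + 1)" if "z \<in> K" for z
      using that unfolding E_def
      by (simp only: mod_mult_self2 div_mult_self2) (auto simp: K_def)
    from this[OF xy(1)] this[OF xy(2)] xy(3) show "x = y" by (simp only: prod_eq_iff)
  qed
  have key: "\<forall>x\<in>K. c x = 0" if c: "(\<Sum>x\<in>K. fscale (c x) (f x)) = 0" for c
  proof -
    define q where "q = (\<Sum>x\<in>K. monom (c x) (E x))"
    have "poly q t = 0" for t
    proof -
      have "poly q t = (\<Sum>x\<in>K. fscale (c x) (f x) (vector [1, t, t ^ (d + 1)]))"
        unfolding q_def poly_sum poly_monom fscale_def f_eval ..
      also have "\<dots> = (\<Sum>x\<in>K. fscale (c x) (f x)) (vector [1, t, t ^ (d + 1)])"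
        using fin by (induction K rule: finite_induct) simp_all
      finally show ?thesis unfolding c by simp
    qed
    then have "q = 0" using poly_all_0_iff_0 by blast
    show ?thesis
    proof
      fix x assume x: "x \<in> K"
      have "coeff q (E x) = (\<Sum>y\<in>K. if E y = E x then c y else 0)"
        by (simp add: q_def coeff_sum)
      also have "\<dots> = (\<Sum>y\<in>K. if y = x then c y else 0)"
        using inj_onD[OF inj_E _ _ x] by (intro sum.cong) auto
      also have "\<dots> = c x" using fin x by simp
      finally show "c x = 0" by (simp add: \<open>q = 0\<close>)
    qed
  qed
  have inj_f: "inj_on f K"
  proof (rule inj_onI)
    fix x y assume xy: "x \<in> K" "y \<in> K" "f x = f y"
    then have "(2 :: complex) ^ E x = 2 ^ E y" by (metis f_eval)
    then have "(2 :: nat) ^ E x = 2 ^ E y" by (metis of_nat_eq_iff of_nat_numeral of_nat_power)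
    then have "E x = E y" by simp
    then show "x = y" using inj_onD[OF inj_E] xy(1,2) by blast
  qed
  have "fun_vs.independent (f ` K)"
    unfolding fun_vs.dependent_finite[OF finite_imageI[OF fin]]
  proof (rule notI, elim exE conjE)
    fix u assume u: "\<exists>v\<in>f ` K. u v \<noteq> 0" "(\<Sum>v\<in>f ` K. fscale (u v) v) = 0"
    have "(\<Sum>x\<in>K. fscale (u (f x)) (f x)) = 0"
      using u(2) unfolding sum.reindex[OF inj_f] o_def .
    from key[OF this] show False using u(1) by simp
  qed
  moreover have "f ` K \<subseteq> forms d"
    by (auto simp: f_def K_def sum_3 intro!: monomial_in_forms)
  ultimately have "card (f ` K) \<le> fun_vs.dim (forms d :: (complex^3 \<Rightarrow> complex) set)"
    by (rule card_le_dim[OF _ _ forms_fin_gen finite_imageI[OF finite_exponents]])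
  moreover have "card (f ` K) = (d + 2) choose 2"
    using card_image[OF inj_f] card_triangle[of "d + 1"] by (simp add: K_def)
  ultimately show ?thesis by simp
qed

text \<open>In coordinates in which the point is \<open>(1, 0, 0)\<close>, the forms with a point of multiplicity
  \<open>k\<close> are spanned by the monomials of degree at least \<open>k\<close> in the last two coordinates.\<close>

lemma forms_subset_span_vanishing:
  fixes q b2 b3 :: "complex^3"
  assumes "\<And>x y z. x *s q + y *s b2 + z *s b3 = 0 \<Longrightarrow> x = 0 \<and> y = 0 \<and> z = 0"
  shows "\<exists>T. finite T \<and> card T \<le> (k + 1) choose 2 \<and>
    forms d \<subseteq> fun_vs.span ({F. vanishes_to_order k q F} \<union> T)"
proof -
  obtain A B :: "complex^3^3" where AB: "\<And>x. A *v (B *v x) = x" "\<And>x. B *v (A *v x) = x"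
    "\<And>x. A *v x = x $ 1 *s q + x $ 2 *s b2 + x $ 3 *s b3"
    using basis_matrix_3[OF assms] by metis
  have "A *v vector [1, 0, 0] = q" by (simp add: AB(3))
  then have Bq: "B *v q = vector [1, 0, 0]" using AB(2) by metis
  define K where "K = (SIGMA b:{..<k}. {..<k - b})"
  define T where "T = (\<lambda>bc x. monomial (exponents d bc) (B *v x)) ` K"
  have "finite T" by (simp add: T_def K_def)
  moreover have "card T \<le> (k + 1) choose 2"
    unfolding T_def card_triangle[symmetric] K_def[symmetric]
    by (rule card_image_le) (simp add: K_def)
  moreover have "forms d \<subseteq> fun_vs.span ({F. vanishes_to_order k q F} \<union> T)"
  proof
    fix F :: "complex^3 \<Rightarrow> complex" assume "F \<in> forms d"
    then have F': "(\<lambda>x. F (A *v x)) \<in> fun_vs.span {monomial a |a. sum a UNIV = d}"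
      using forms_linear_substitute[of F d A] by (simp add: forms_def)
    have "(\<lambda>x. F (A *v (B *v x))) \<in> fun_vs.span ({F. vanishes_to_order k q F} \<union> T)"
    proof (rule span_substitute[OF F', of "\<lambda>x. B *v x"])
      fix x assume "x \<in> {monomial a |a :: 3 \<Rightarrow> nat. sum a UNIV = d}"
      then obtain a where a: "x = monomial a" "sum a UNIV = d" by blast
      have "(\<lambda>v. monomial a (B *v v)) \<in> {F. vanishes_to_order k q F} \<union> T"
      proof (cases "a 2 + a 3 < k")
        case True
        then have "(a 2, a 3) \<in> K" by (auto simp: K_def)
        then have "(\<lambda>v. monomial (exponents d (a 2, a 3)) (B *v v)) \<in> T"
          unfolding T_def by (rule image_eqI[OF refl])
        then show ?thesis using exponents_of_degree[OF a(2)] by simp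
      next
        case False
        have "monomial a (B *v (q + v))
            = (1 + (B *v v) $ 1) ^ a 1 * ((B *v v) $ 2 ^ a 2 * (B *v v) $ 3 ^ a 3)" for v
          by (simp add: monomial_3 matrix_vector_right_distrib Bq mult.assoc)
        moreover have "(\<lambda>v. (1 + (B *v v) $ 1) ^ a 1 * ((B *v v) $ 2 ^ a 2 * (B *v v) $ 3 ^ a 3))
            \<in> order_ge (0 + (a 2 + a 3))"
        proof (rule order_ge_mult)
          show "(\<lambda>v. (1 + (B *v v) $ 1) ^ a 1) \<in> order_ge 0"
            by (intro polynomial_power order_ge_add forms_polynomial[OF const_in_forms]
                forms_polynomial[OF linear_in_forms])
          have "(\<lambda>v. (B *v v) $ 2 ^ a 2 * (B *v v) $ 3 ^ a 3) \<in> forms (1 * a 2 + 1 * a 3)"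
            by (intro forms_mult forms_power linear_in_forms)
          then show "(\<lambda>v. (B *v v) $ 2 ^ a 2 * (B *v v) $ 3 ^ a 3) \<in> order_ge (a 2 + a 3)"
            using forms_subset_order_ge[of "a 2 + a 3" "a 2 + a 3"] by auto
        qed
        ultimately have "(\<lambda>v. monomial a (B *v (q + v))) \<in> order_ge (a 2 + a 3)" by simp
        then have "(\<lambda>v. monomial a (B *v (q + v))) \<in> order_ge k"
          using order_ge_antimono[of k "a 2 + a 3"] False by auto
        then show ?thesis by (simp add: vanishes_iff_order_ge)
      qed
      then show "(\<lambda>v. x (B *v v)) \<in> fun_vs.span ({F. vanishes_to_order k q F} \<union> T)"
        unfolding a(1) by (rule fun_vs.span_base)
    qed
    then show "F \<in> fun_vs.span ({F. vanishes_to_order k q F} \<union> T)" by (simp only: AB(1))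
  qed
  ultimately show ?thesis by blast
qed

text \<open>Imposing the five multiplicities one after the other, each of them costs at most as many
  dimensions as there are monomials violating it, whatever subspace the previous ones have left.\<close>

lemma linsys_dim_ge_vdim:
  fixes p :: "nat \<Rightarrow> complex^3"
  assumes gp: "general_position p"
  shows "vdim 2 d m \<le> int (linsys_dim p d m)"
proof -
  define L where "L = (\<lambda>n :: nat. {F \<in> forms d. \<forall>i \<in> {1..n}. vanishes_to_order (m i) (p i) F})"
  have sub: "fun_vs.subspace (L n)" for n
  proof -
    have "L n = forms d \<inter> \<Inter> ((\<lambda>i. {F. vanishes_to_order (m i) (p i) F}) ` {1..n})"
      unfolding L_def by blast
    also have "fun_vs.subspace \<dots>"
      by (intro fun_vs.subspace_inter subspace_forms fun_vs.subspace_Inter)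
        (auto intro: subspace_vanishes)
    finally show ?thesis .
  qed
  have "(d + 2) choose 2 \<le> fun_vs.dim (L n) + (\<Sum>i = 1..n. (m i + 1) choose 2)" if "n \<le> 5" for n
    using that
  proof (induction n)
    case 0
    show ?case using dim_forms_ge[of d] by (simp add: L_def)
  next
    case (Suc n)
    obtain j where "j \<in> {1..5}" "j \<notin> {Suc n}" by (rule index_outside[of "{Suc n}"]) auto
    moreover have "card {Suc n, j} < 5" by (simp add: card_insert_if)
    then obtain k where "k \<in> {1..5}" "k \<notin> {Suc n, j}" by (rule index_outside) simp
    ultimately have jk: "j \<in> {1..5}" "k \<in> {1..5}" "Suc n \<noteq> j" "Suc n \<noteq> k" "j \<noteq> k" by auto
    have n5: "Suc n \<in> {1..5}" using Suc.prems by simp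
    let ?W = "{F. vanishes_to_order (m (Suc n)) (p (Suc n)) F}"
    have "x = 0 \<and> y = 0 \<and> z = 0" if "x *s p (Suc n) + y *s p j + z *s p k = 0" for x y z
      by (rule general_position_independent[OF gp n5 jk that])
    then have ex_T: "\<exists>T. finite T \<and> card T \<le> (m (Suc n) + 1) choose 2 \<and>
        forms d \<subseteq> fun_vs.span (?W \<union> T)"
      by (rule forms_subset_span_vanishing)
    obtain T where T: "finite T" "card T \<le> (m (Suc n) + 1) choose 2"
      "forms d \<subseteq> fun_vs.span (?W \<union> T)"
      using ex_T by blast
    have L_forms: "L n \<subseteq> forms d" unfolding L_def by blast
    have "fun_vs.dim (L n) \<le> fun_vs.dim (L n \<inter> ?W) + card T"
      by (rule dim_le_dim_Int_plus_card[OF sub subspace_vanishes subset_trans[OF L_forms forms_fin_gen]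
            finite_imageI[OF finite_exponents] T(1) subset_trans[OF L_forms T(3)]])
    moreover have "L n \<inter> ?W = L (Suc n)"
      unfolding L_def by (auto simp: atLeastAtMostSuc_conv)
    ultimately show ?case using Suc.IH Suc.prems T(2) by simp
  qed
  from this[of 5] have "(d + 2) choose 2 \<le> linsys_dim p d m + (\<Sum>i = 1..5. (m i + 1) choose 2)"
    by (simp add: L_def linsys_dim_def linsys_def proj_dim_3)
  then have "int ((d + 2) choose 2) \<le> int (linsys_dim p d m) + (\<Sum>i = 1..5. int ((m i + 1) choose 2))"
    by (simp flip: of_nat_sum of_nat_add)
  then show ?thesis by (simp add: vdim_def add.commute)
qed


section \<open>The secant linear virtual dimension in the plane\<close>

definition index_pairs :: "nat set set" where
  "index_pairs = {I. I \<subseteq> {1..5} \<and> card I = 2}"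

text \<open>The numbers \<open>- D.E\<close> for the lines and the conic: by how much the multiplicities exceed what a
  curve without the component \<open>E\<close> allows.\<close>

definition line_excess :: "nat \<Rightarrow> (nat \<Rightarrow> nat) \<Rightarrow> nat set \<Rightarrow> int" where
  "line_excess d m I = (\<Sum>i\<in>I. int (m i)) - int d"

definition conic_excess :: "nat \<Rightarrow> (nat \<Rightarrow> nat) \<Rightarrow> int" where
  "conic_excess d m = (\<Sum>i = 1..5. int (m i)) - 2 * int d"

lemma finite_index_pairs: "finite index_pairs"
  unfolding index_pairs_def by (rule finite_subset[of _ "Pow {1..5}"]) auto

lemma sec_indices_2:
  "sec_indices 2 = insert ({}, 0) ((\<lambda>i. ({i}, 0)) ` {1..5}) \<union> (\<lambda>I. (I, 0)) ` index_pairs \<union> {({}, 1)}"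
proof -
  have mem: "(I, t) \<in> sec_indices 2 \<longleftrightarrow> I \<subseteq> {1..5} \<and> (card I \<le> 2 \<and> t = 0 \<or> card I = 0 \<and> t = 1)" for I t
    unfolding sec_indices_def by auto
  have mem': "(I, t) \<in> sec_indices 2 \<longleftrightarrow> I \<subseteq> {1..5} \<and>
      (I = {} \<and> t = 0 \<or> (\<exists>i. I = {i}) \<and> t = 0 \<or> card I = 2 \<and> t = 0 \<or> I = {} \<and> t = 1)" for I t
  proof (cases "I \<subseteq> {1..5}")
    case True
    then have 0: "I = {} \<longleftrightarrow> card I = 0" using finite_subset[of I "{1..5}"] by auto
    have 1: "(\<exists>i. I = {i}) \<longleftrightarrow> card I = 1" by (simp add: card_1_singleton_iff)
    show ?thesis unfolding mem 0 1 using True by arith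
  qed (simp add: mem)
  show ?thesis
  proof (rule set_eqI)
    fix x :: "nat set \<times> nat"
    obtain I t where x: "x = (I, t)" by (cases x)
    show "x \<in> sec_indices 2 \<longleftrightarrow> x \<in> insert ({}, 0) ((\<lambda>i. ({i}, 0)) ` {1..5})
        \<union> (\<lambda>I. (I, 0)) ` index_pairs \<union> {({}, 1)}"
      unfolding x mem' index_pairs_def image_iff Un_iff insert_iff prod.inject Bex_def mem_Collect_eq
        empty_iff by blast
  qed
qed

text \<open>The empty set and the single points, which correspond to \<open>d\<close> and the \<open>m i\<close>, contribute the
  virtual dimension.\<close>

lemma sec_lin_vdim_2:
  "sec_lin_vdim 2 d m = vdim 2 d m + (\<Sum>I\<in>index_pairs. binom0 (line_excess d m I) 2)
    + binom0 (conic_excess d m) 2"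
proof -
  define f where "f = (\<lambda>(I, t). (- 1) ^ card I * binom0 (int 2 + k_sec 2 d m I t - r_sec I t - 1) 2)"
  have "{({} :: nat set, 1 :: nat)} \<inter> (insert ({}, 0) ((\<lambda>i. ({i}, 0)) ` {1..5}) \<union> (\<lambda>I. (I, 0)) ` index_pairs) = {}"
    by auto
  then have "sum f (sec_indices 2) = sum f (insert ({}, 0) ((\<lambda>i. ({i}, 0)) ` {1..5}) \<union> (\<lambda>I. (I, 0)) ` index_pairs)
      + sum f {({}, 1)}"
    unfolding sec_indices_2 by (intro sum.union_disjoint) (auto intro: finite_index_pairs)
  also have "sum f (insert ({}, 0) ((\<lambda>i. ({i}, 0)) ` {1..5}) \<union> (\<lambda>I. (I, 0)) ` index_pairs)
      = sum f (insert ({}, 0) ((\<lambda>i. ({i}, 0)) ` {1..5})) + sum f ((\<lambda>I. (I, 0)) ` index_pairs)"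
    by (intro sum.union_disjoint) (auto intro: finite_index_pairs simp: index_pairs_def)
  also have "sum f (insert ({}, 0) ((\<lambda>i. ({i}, 0)) ` {1..5})) = f ({}, 0) + sum f ((\<lambda>i. ({i}, 0)) ` {1..5})"
    by (intro sum.insert) auto
  also have "sum f ((\<lambda>i. ({i}, 0)) ` {1..5}) = (\<Sum>i = 1..5. f ({i}, 0))"
    by (subst sum.reindex) (auto simp: inj_on_def)
  also have "sum f ((\<lambda>I. (I, 0)) ` index_pairs) = (\<Sum>I\<in>index_pairs. f (I, 0))"
    by (subst sum.reindex) (auto simp: inj_on_def)
  also have "f ({}, 0) = int ((2 + d) choose 2)"
    by (simp add: f_def k_sec_def r_sec_def binom0_def nat_add_distrib add.commute)
  also have "(\<Sum>i = 1..5. f ({i}, 0)) = (\<Sum>i = 1..5. - int ((2 + m i - 1) choose 2))"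
  proof (rule sum.cong[OF refl])
    fix i
    show "f ({i}, 0) = - int ((2 + m i - 1) choose 2)"
      by (cases "m i")
        (simp_all add: f_def k_sec_def r_sec_def binom0_def numeral_2_eq_2 nat_add_distrib del: binomial_Suc_Suc)
  qed
  also have "(\<Sum>I\<in>index_pairs. f (I, 0)) = (\<Sum>I\<in>index_pairs. binom0 (line_excess d m I) 2)"
    by (intro sum.cong refl)
      (simp add: f_def k_sec_def r_sec_def line_excess_def index_pairs_def)
  also have "sum f {({}, 1)} = binom0 (conic_excess d m) 2"
    by (simp add: f_def k_sec_def r_sec_def kC_def conic_excess_def)
  finally show ?thesis
    by (simp add: sec_lin_vdim_def f_def vdim_def sum_negf)
qed

lemma binom0_le_1: "k \<le> 1 \<Longrightarrow> binom0 k 2 = 0"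
  by (simp add: binom0_def)

lemma binom0_step: "1 \<le> k \<Longrightarrow> binom0 k 2 = binom0 (k - 1) 2 + (k - 1)"
proof -
  assume "1 \<le> k"
  define n where "n = nat (k - 1)"
  with \<open>1 \<le> k\<close> have n: "k = int (Suc n)" by simp
  show ?thesis
  proof (cases "n \<le> 1")
    case True
    then show ?thesis by (cases n) (auto simp: n binom0_def)
  next
    case False
    then have "binom0 k 2 = int (Suc n choose 2)" "binom0 (k - 1) 2 = int (n choose 2)"
      by (simp_all add: n binom0_def nat_add_distrib)
    then show ?thesis by (simp add: n numeral_2_eq_2)
  qed
qed

text \<open>Doubling clears the denominators of the binomial coefficients.\<close>

lemma choose_2_double: "2 * int ((n + 1) choose 2) = int n * (int n + 1)"
proof -
  have "even (Suc n * n)" by simp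
  then have "2 * ((n + 1) choose 2) = Suc n * n" by (simp add: choose_two)
  then have "int (2 * ((n + 1) choose 2)) = int (Suc n * n)" by (rule arg_cong)
  then show ?thesis by (simp add: algebra_simps)
qed

lemma vdim_2_double:
  "2 * vdim 2 d m = (int d + 1) * (int d + 2) - (\<Sum>i = 1..5. int (m i) * (int (m i) + 1))"
proof -
  have "2 * vdim 2 d m = 2 * int (((d + 1) + 1) choose 2) - (\<Sum>i = 1..5. 2 * int ((m i + 1) choose 2))"
    by (simp add: vdim_def sum_distrib_left algebra_simps)
  then show ?thesis unfolding choose_2_double by (simp add: algebra_simps)
qed

lemma sum_reduce_on:
  assumes "I \<subseteq> {1..5}"
  shows "(\<Sum>i = 1..5. int (m i) * (int (m i) + 1))
    = (\<Sum>i = 1..5. int (reduce_on I m i) * (int (reduce_on I m i) + 1)) + 2 * (\<Sum>i\<in>I. int (m i))"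
proof -
  have "int (m i) * (int (m i) + 1) = int (reduce_on I m i) * (int (reduce_on I m i) + 1)
      + (if i \<in> I then 2 * int (m i) else 0)" for i
    by (cases "m i") (auto simp: reduce_on_def algebra_simps)
  then have "(\<Sum>i = 1..5. int (m i) * (int (m i) + 1))
    = (\<Sum>i = 1..5. int (reduce_on I m i) * (int (reduce_on I m i) + 1))
      + (\<Sum>i = 1..5. if i \<in> I then 2 * int (m i) else 0)"
    by (simp only: sum.distrib)
  also have "(\<Sum>i = 1..5. if i \<in> I then 2 * int (m i) else 0) = 2 * (\<Sum>i\<in>I. int (m i))"
    using assms by (simp add: sum_distrib_left Int_absorb1 flip: sum.inter_restrict)
  finally show ?thesis .
qed

lemma halve_difference:
  fixes v v' X Y A B a b :: int
  assumes "2 * v = X - A" "2 * v' = Y - B" "A = B + 2 * a" "Y + 2 * b = X"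
  shows "v = v' + (b - a)"
  using assms by linarith

text \<open>By Riemann-Roch, the virtual dimensions of \<open>D\<close> and \<open>D - E\<close> differ by the Euler characteristic
  \<open>D.E + 1\<close> of the restriction to the rational curve \<open>E\<close>. In the plane this is a direct computation.\<close>

lemma vdim_reduce_line:
  assumes "1 \<le> d" "I \<subseteq> {1..5}"
  shows "vdim 2 d m = vdim 2 (d - 1) (reduce_on I m) + (int d + 1 - (\<Sum>i\<in>I. int (m i)))"
proof -
  have d: "int (d - 1) = int d - 1" using assms(1) by simp
  have "(int (d - 1) + 1) * (int (d - 1) + 2) + 2 * (int d + 1) = (int d + 1) * (int d + 2)"
    unfolding d by (simp add: algebra_simps)
  then show ?thesis
    by (rule halve_difference[OF vdim_2_double vdim_2_double sum_reduce_on[OF assms(2)]])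
qed

lemma vdim_reduce_conic:
  assumes "2 \<le> d"
  shows "vdim 2 d m = vdim 2 (d - 2) (reduce_on {1..5} m) + (2 * int d + 1 - (\<Sum>i = 1..5. int (m i)))"
proof -
  have d: "int (d - 2) = int d - 2" using assms(1) by simp
  have "(int (d - 2) + 1) * (int (d - 2) + 2) + 2 * (2 * int d + 1) = (int d + 1) * (int d + 2)"
    unfolding d by (simp add: algebra_simps)
  then show ?thesis
    by (rule halve_difference[OF vdim_2_double vdim_2_double sum_reduce_on[OF order_refl]])
qed

lemma sum_reduce_pos:
  assumes "finite J" "\<And>i. i \<in> I \<Longrightarrow> 1 \<le> m i"
  shows "(\<Sum>i\<in>J. int (reduce_on I m i)) = (\<Sum>i\<in>J. int (m i)) - int (card (J \<inter> I))"
proof -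
  have "int (reduce_on I m i) = int (m i) - (if i \<in> I then 1 else 0)" for i
    using assms(2)[of i] by (auto simp: reduce_on_def)
  then have "(\<Sum>i\<in>J. int (reduce_on I m i)) = (\<Sum>i\<in>J. int (m i)) - (\<Sum>i\<in>J. if i \<in> I then 1 else 0)"
    by (simp only: sum_subtractf)
  also have "(\<Sum>i\<in>J. if i \<in> I then 1 else 0) = int (card (J \<inter> I))"
    using assms(1) by (simp add: sum.If_cases)
  finally show ?thesis .
qed

text \<open>A line that shares one base point with \<open>E\<close> is disjoint from it on the blow-up, as is the conic,
  so their excesses stay the same. The excess of a line through two other base points grows by one,
  and \<open>disj\<close> makes sure that it is at most 0 afterwards.\<close>

lemma sec_lin_vdim_reduce_line:
  assumes I: "I \<in> index_pairs" "1 \<le> d" "\<And>i. i \<in> I \<Longrightarrow> 1 \<le> m i" "0 < line_excess d m I"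
    and disj: "\<And>J. J \<in> index_pairs \<Longrightarrow> I \<inter> J = {} \<Longrightarrow> line_excess d m I + line_excess d m J \<le> 0"
  shows "sec_lin_vdim 2 d m = sec_lin_vdim 2 (d - 1) (reduce_on I m)"
proof -
  have I5: "I \<subseteq> {1..5}" "card I = 2" "finite I"
    using I(1) finite_subset[of I "{1..5}"] by (auto simp: index_pairs_def)
  let ?m = "reduce_on I m" and ?t = "\<lambda>k. binom0 k 2"
  have line: "line_excess (d - 1) ?m J = line_excess d m J - int (card (J \<inter> I)) + 1"
    if "J \<in> index_pairs" for J
  proof -
    have "finite J" using that finite_subset[of J "{1..5}"] by (auto simp: index_pairs_def)
    then show ?thesis using sum_reduce_pos[of J I m] I(2,3)
      by (simp add: line_excess_def)
  qed
  have "conic_excess (d - 1) ?m = conic_excess d m"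
    using sum_reduce_pos[of "{1..5}" I m] I(2,3) I5 by (simp add: conic_excess_def Int_absorb1)
  moreover have "(\<Sum>J\<in>index_pairs - {I}. ?t (line_excess (d - 1) ?m J))
      = (\<Sum>J\<in>index_pairs - {I}. ?t (line_excess d m J))"
  proof (rule sum.cong[OF refl])
    fix J assume J: "J \<in> index_pairs - {I}"
    then have J2: "card J = 2" "finite J" using finite_subset[of J "{1..5}"] by (auto simp: index_pairs_def)
    show "?t (line_excess (d - 1) ?m J) = ?t (line_excess d m J)"
    proof (cases "I \<inter> J = {}")
      case True
      then have "line_excess (d - 1) ?m J = line_excess d m J + 1" using line J by (simp add: Int_commute)
      moreover have "line_excess d m J < 0" using disj[OF _ True] J I(4) by fastforce
      ultimately show ?thesis by (simp add: binom0_le_1)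
    next
      case False
      have "J \<inter> I \<noteq> J"
      proof
        assume "J \<inter> I = J"
        then have "J = I" using card_subset_eq[of I J] I5 J2 by auto
        then show False using J by simp
      qed
      then have "card (J \<inter> I) < 2" using psubset_card_mono[of J "J \<inter> I"] J2 by auto
      moreover have "0 < card (J \<inter> I)" using False J2 by (auto simp: card_gt_0_iff Int_commute)
      ultimately have "card (J \<inter> I) = 1" by simp
      then show ?thesis using line J by simp
    qed
  qed
  moreover have "?t (line_excess d m I) = ?t (line_excess (d - 1) ?m I) + (line_excess d m I - 1)"
    using binom0_step[of "line_excess d m I"] I(4) line[OF I(1)] I5 by simp
  ultimately show ?thesis
    unfolding sec_lin_vdim_2 sum.remove[OF finite_index_pairs I(1)] vdim_reduce_line[OF I(2) I5(1)]
    by (simp add: line_excess_def)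
qed

text \<open>On the blow-up the conic is disjoint from all lines.\<close>

lemma sec_lin_vdim_reduce_conic:
  assumes "2 \<le> d" "\<And>i. i \<in> {1..5} \<Longrightarrow> 1 \<le> m i" "0 < conic_excess d m"
  shows "sec_lin_vdim 2 d m = sec_lin_vdim 2 (d - 2) (reduce_on {1..5} m)"
proof -
  let ?m = "reduce_on {1..5} m"
  have "line_excess (d - 2) ?m J = line_excess d m J" if "J \<in> index_pairs" for J
  proof -
    have "J \<subseteq> {1..5}" "card J = 2" "finite J"
      using that finite_subset[of J "{1..5}"] by (auto simp: index_pairs_def)
    then show ?thesis using sum_reduce_pos[of J "{1..5}" m] assms(1,2)
      by (simp add: line_excess_def Int_absorb2)
  qed
  moreover have "conic_excess (d - 2) ?m = conic_excess d m - 1"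
    using sum_reduce_pos[of "{1..5}" "{1..5}" m] assms(1,2) by (simp add: conic_excess_def)
  ultimately show ?thesis
    unfolding sec_lin_vdim_2 vdim_reduce_conic[OF assms(1)]
    using binom0_step[of "conic_excess d m"] assms(3) by (simp add: conic_excess_def)
qed

lemma sec_lin_vdim_eq_vdim:
  assumes "\<And>I. I \<in> index_pairs \<Longrightarrow> line_excess d m I \<le> 1" "conic_excess d m \<le> 1"
  shows "sec_lin_vdim 2 d m = vdim 2 d m"
  using assms by (simp add: sec_lin_vdim_2 binom0_le_1)

lemma two_largest:
  fixes m :: "nat \<Rightarrow> nat"
  obtains i j where "i \<in> {1..5}" "j \<in> {1..5}" "i \<noteq> j" "m j \<le> m i" "\<forall>l \<in> {1..5} - {i, j}. m l \<le> m j"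
proof -
  have ex: "\<exists>i\<in>S. \<forall>l\<in>S. m l \<le> m i" if "finite S" "S \<noteq> {}" for S
  proof -
    have "Max (m ` S) \<in> m ` S" using that by (intro Max_in) auto
    then obtain i where "i \<in> S" "Max (m ` S) = m i" by blast
    then show ?thesis using Max_ge[of "m ` S"] that(1) by (intro bexI[of _ i]) auto
  qed
  obtain i where i: "i \<in> {1..5}" "\<forall>l\<in>{1..5}. m l \<le> m i" using ex[of "{1..5}"] by auto
  have "{1..5} - {i} \<noteq> {}" by (rule index_outside[of "{i}"]) auto
  then have "\<exists>j\<in>{1..5} - {i}. \<forall>l\<in>{1..5} - {i}. m l \<le> m j" by (intro ex) simp
  then obtain j where j: "j \<in> {1..5} - {i}" "\<forall>l\<in>{1..5} - {i}. m l \<le> m j" by blast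
  show ?thesis by (rule that[of i j]) (use i j in auto)
qed

text \<open>Here \<open>D\<close> is nef. Twice the virtual dimension of \<open>D - E\<close> is \<open>D\<^sup>2\<close> plus a linear expression, which is
  nonnegative because \<open>E\<close> joins the points of largest multiplicity; and \<open>D\<^sup>2 \<ge> 0\<close>. With the two largest
  multiplicities \<open>a\<close> and \<open>b\<close>, the sum of the squares of the others is at most \<open>b\<close> times their sum, and
  the resulting bound for \<open>D\<^sup>2\<close> is linear in \<open>b\<close>, so that the extreme cases \<open>b = d - a\<close> and \<open>b = a\<close>
  suffice.\<close>

lemma residual_vdim_nonneg:
  assumes ij: "i \<in> {1..5}" "j \<in> {1..5}" "i \<noteq> j" "m j \<le> m i"
      "\<forall>l \<in> {1..5} - {i, j}. m l \<le> m j"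
    and d: "1 \<le> d" "int (m i) + int (m j) \<le> int d" "(\<Sum>l = 1..5. int (m l)) \<le> 2 * int d"
  shows "0 \<le> vdim 2 (d - 1) (reduce_on {i, j} m)"
proof -
  define R where "R = {1..5} - {i, j}"
  define a b D c q where "a = int (m i)" and "b = int (m j)" and "D = int d"
    and "c = (\<Sum>l\<in>R. int (m l))" and "q = (\<Sum>l\<in>R. int (m l) * int (m l))"
  have split: "(\<Sum>l = 1..5. f l) = f i + f j + (\<Sum>l\<in>R. f l)" for f :: "nat \<Rightarrow> int"
  proof -
    have "(\<Sum>l = 1..5. f l) = f i + (\<Sum>l\<in>{1..5} - {i}. f l)"
      using ij(1) by (intro sum.remove) simp
    also have "(\<Sum>l\<in>{1..5} - {i}. f l) = f j + (\<Sum>l\<in>{1..5} - {i} - {j}. f l)"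
      using ij(2,3) by (intro sum.remove) auto
    also have "{1..5} - {i} - {j} = R" unfolding R_def by blast
    finally show ?thesis by simp
  qed
  have ab: "0 \<le> b" "b \<le> a" "a + b \<le> D" "a + b + c \<le> 2 * D"
    using ij(4) d(2,3) split[of "\<lambda>l. int (m l)"] by (simp_all add: a_def b_def D_def c_def)
  have "q \<le> (\<Sum>l\<in>R. b * int (m l))"
    unfolding q_def using ij(5) by (intro sum_mono mult_right_mono) (auto simp: b_def R_def)
  also have "\<dots> = b * c" by (simp add: c_def sum_distrib_left)
  also have "\<dots> \<le> b * (2 * D - a - b)" using ab by (intro mult_left_mono) auto
  finally have q: "q \<le> b * (2 * D - a - b)" .
  have "c \<le> (\<Sum>l\<in>R. b)"
    unfolding c_def using ij(5) by (intro sum_mono) (auto simp: b_def R_def)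
  also have "\<dots> = 3 * b" using ij(1-3) by (simp add: R_def)
  finally have c: "c \<le> 3 * b" .
  \<comment> \<open>the self-intersection of a nef class is nonnegative\<close>
  have sq: "0 \<le> D * D - a * a - b * (2 * D - a)"
  proof (cases "D \<le> 2 * a")
    case True
    have "b * (2 * D - a) \<le> (D - a) * (2 * D - a)" using ab by (intro mult_right_mono) auto
    moreover have "0 \<le> (D - a) * (2 * a - D)" using ab True by (intro mult_nonneg_nonneg) auto
    ultimately show ?thesis by (simp add: algebra_simps)
  next
    case False
    have "b * (2 * D - a) \<le> a * (2 * D - a)" using ab by (intro mult_right_mono) auto
    moreover have "0 \<le> D * (D - 2 * a)" using ab False by (intro mult_nonneg_nonneg) auto
    ultimately show ?thesis by (simp add: algebra_simps)
  qed
  have "2 * vdim 2 d m = (D + 1) * (D + 2) - (a * (a + 1) + b * (b + 1) + (q + c))"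
    unfolding vdim_2_double split by (simp add: a_def b_def D_def c_def q_def sum.distrib algebra_simps)
  moreover have "vdim 2 d m = vdim 2 (d - 1) (reduce_on {i, j} m) + (D + 1 - (a + b))"
    using vdim_reduce_line[OF d(1), of "{i, j}" m] ij(1-3) by (simp add: a_def b_def D_def)
  ultimately have "2 * vdim 2 (d - 1) (reduce_on {i, j} m)
      = D * D + D - a * a - b * b + a + b - q - c"
    by (simp add: algebra_simps)
  moreover have "0 \<le> D * D + D - a * a - b * b + a + b - q - c"
    using sq q c ab by (simp add: algebra_simps)
  ultimately show ?thesis by linarith
qed


section \<open>The dimension formula\<close>

lemma multiplicity_le_degree:
  fixes p :: "nat \<Rightarrow> complex^3"
  assumes "linsys p d m \<noteq> {0}" "i \<in> {1..5}"
  shows "m i \<le> d"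
proof (rule ccontr)
  assume i: "\<not> m i \<le> d"
  have "F = 0" if F: "F \<in> linsys p d m" for F :: "complex^3 \<Rightarrow> complex"
    using vanishing_order_gt_degree[of F d "m i" "p i"] F i assms(2)
    by (simp add: linsys_def proj_dim_3)
  then show False using assms(1) fun_vs.subspace_0[OF subspace_linsys, of p d m] by blast
qed

lemma line_through_pair:
  fixes p :: "nat \<Rightarrow> complex^3"
  assumes gp: "general_position p" and I: "I \<in> index_pairs"
  obtains P w s \<mu> where "rational_curve p P 1 w I s \<mu>"
    "\<And>x. x \<in> vec.span (p ` I) \<Longrightarrow> P x = 0"
proof -
  obtain i j where ij: "I = {i, j}" "i \<noteq> j" "i \<in> {1..5}" "j \<in> {1..5}"
    using I by (auto simp: index_pairs_def card_2_iff)
  obtain P w s \<mu> where "rational_curve p P 1 w {i, j} s \<mu>"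
    "\<And>x. x \<in> vec.span {p i, p j} \<Longrightarrow> P x = 0"
    using line_through_points[OF gp ij(3,4,2)] by metis
  then show ?thesis using that by (simp add: ij(1))
qed

lemma line_excess_eq: "line_excess d m I = int (sum m I) - int d"
  by (simp add: line_excess_def)

lemma conic_excess_eq: "conic_excess d m = int (sum m {1..5}) - 2 * int d"
  by (simp add: conic_excess_def)

lemma finite_pair: "I \<in> index_pairs \<Longrightarrow> finite I"
  unfolding index_pairs_def using finite_subset[of I "{1..5}"] by simp

text \<open>The two lines form a degenerate conic of the pencil through four base points. If their total
  excess were positive, one of them would be a fixed component. Splitting it off lowers the degree by
  one and the sum of the four multiplicities by at most two, so the residual, of smaller degree, would
  again be a counterexample.\<close>

lemma disjoint_lines_excess:
  fixes p :: "nat \<Rightarrow> complex^3"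
  assumes gp: "general_position p"
  shows "linsys p d m \<noteq> {0} \<Longrightarrow> I \<in> index_pairs \<Longrightarrow> J \<in> index_pairs \<Longrightarrow> I \<inter> J = {} \<Longrightarrow>
    line_excess d m I + line_excess d m J \<le> 0"
proof (induction d arbitrary: m I J rule: less_induct)
  case (less d)
  show ?case
  proof (rule ccontr)
    assume "\<not> ?thesis"
    then have big: "2 * d < sum m I + sum m J" unfolding line_excess_eq by linarith
    have step: False if K: "K \<in> index_pairs" "K' \<in> index_pairs" "K \<inter> K' = {}" "d < sum m K"
      "2 * d < sum m K + sum m K'" for K K'
    proof -
      obtain P w s \<mu> where "rational_curve p P 1 w K s \<mu>"
        using line_through_pair[OF gp K(1)] by metis
      then interpret rational_curve p P 1 w K s \<mu> .
      have res: "1 \<le> d" "linsys p (d - 1) (reduce_on K m) \<noteq> {0}"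
        using fixed_curve_residual[OF less.prems(1)] K(4) by simp_all
      have "line_excess (d - 1) (reduce_on K m) K + line_excess (d - 1) (reduce_on K m) K' \<le> 0"
        by (rule less.IH[OF _ res(2) K(1-3)]) (use res(1) in simp)
      moreover have "sum m K \<le> sum (reduce_on K m) K + 2"
      proof -
        have "sum m K \<le> (\<Sum>i\<in>K. reduce_on K m i + 1)"
          by (rule sum_mono) (simp add: reduce_on_def)
        then show ?thesis using K(1) unfolding sum.distrib by (simp add: index_pairs_def)
      qed
      moreover have "sum (reduce_on K m) K' = sum m K'"
        using K(3) by (intro sum.cong refl) (auto simp: reduce_on_def)
      ultimately show False using K(5) res(1) unfolding line_excess_eq by linarith
    qed
    have "J \<inter> I = {}" using less.prems(4) by blast
    moreover have "d < sum m I \<or> d < sum m J" using big by linarith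
    ultimately show False
      using step[OF less.prems(2-4)] step[OF less.prems(3,2)] big by linarith
  qed
qed

text \<open>An effective class has nonnegative degree on the conics through four of the points, by
  degeneration to a pair of lines.\<close>

lemma four_points_degree:
  fixes p :: "nat \<Rightarrow> complex^3"
  assumes "general_position p" "linsys p d m \<noteq> {0}" "J \<subseteq> {1..5}" "card J = 4"
  shows "sum m J \<le> 2 * d"
proof -
  have fin: "finite J" using assms(3) by (rule finite_subset) simp
  obtain I where I: "I \<subseteq> J" "card I = 2"
    by (rule obtain_subset_with_card_n[of 2 J]) (use assms(4) in simp)
  have "card (J - I) = 2" using I assms(4) fin by (simp add: card_Diff_subset finite_subset)
  then have "I \<in> index_pairs" "J - I \<in> index_pairs" "I \<inter> (J - I) = {}"
    using I assms(3) by (auto simp: index_pairs_def)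
  from disjoint_lines_excess[OF assms(1,2) this] have "sum m I + sum m (J - I) \<le> 2 * d"
    unfolding line_excess_eq by linarith
  then show ?thesis using sum.subset_diff[OF I(1) fin, of m] by simp
qed

lemma linsys_dim_degree_0:
  fixes p :: "nat \<Rightarrow> complex^3"
  shows "linsys_dim p 0 m \<le> 1"
proof -
  have "{a :: 3 \<Rightarrow> nat. sum a UNIV = 0} = {\<lambda>i. 0}" by (auto simp: fun_eq_iff)
  then have "linsys p 0 m \<subseteq> fun_vs.span {monomial (\<lambda>i. 0)}"
    using linsys_fin_gen[of p 0 m] by simp
  then have "fun_vs.dim (linsys p 0 m) \<le> card {monomial (\<lambda>i::3. 0)}"
    by (rule fun_vs.dim_le_card) simp
  then show ?thesis by (simp add: linsys_dim_def)
qed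

text \<open>The three cases of the induction: a fixed line, the fixed conic, and a nef class. In the
  first two, all base points on the fixed curve have positive multiplicity, so that no multiplicity
  of the residual class is truncated.\<close>

lemma linsys_dim_formula:
  fixes p :: "nat \<Rightarrow> complex^3"
  assumes gp: "general_position p" and conic: "rational_curve p P 2 w {1..5} s \<mu>"
  shows "linsys p d m \<noteq> {0} \<Longrightarrow> int (linsys_dim p d m) = sec_lin_vdim 2 d m"
proof (induction d arbitrary: m rule: less_induct)
  case (less d)
  note L = less.prems
  interpret conic: rational_curve p P 2 w "{1..5}" s \<mu> by (rule conic)
  consider (line) I where "I \<in> index_pairs" "0 < line_excess d m I"
    | (conic) "0 < conic_excess d m"
    | (nef) "\<And>I. I \<in> index_pairs \<Longrightarrow> line_excess d m I \<le> 0" "conic_excess d m \<le> 0"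
    by (meson not_le)
  then show ?case
  proof cases
    case line
    obtain P' w' s' \<mu>' where "rational_curve p P' 1 w' I s' \<mu>'"
      using line_through_pair[OF gp line(1)] by metis
    then interpret rational_curve p P' 1 w' I s' \<mu>' .
    have fixed: "1 * d < sum m I" using line(2) unfolding line_excess_eq by linarith
    note res = fixed_curve_residual[OF L fixed]
    have pos: "1 \<le> m i" if "i \<in> I" for i
    proof -
      have "card (I - {i}) = 1" using line(1) that by (simp add: index_pairs_def)
      then obtain j where j: "I - {i} = {j}" by (rule card_1_singletonE)
      have "sum m I = m i + m j"
        using sum.remove[OF finite_pair[OF line(1)] that, of m] by (simp add: j)
      moreover have "j \<in> I - {i}" by (simp add: j)
      then have "j \<in> {1..5}" using line(1) by (auto simp: index_pairs_def)
      then have "m j \<le> d" by (rule multiplicity_le_degree[OF L])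
      ultimately show ?thesis using fixed by simp
    qed
    have "sec_lin_vdim 2 d m = sec_lin_vdim 2 (d - 1) (reduce_on I m)"
      by (rule sec_lin_vdim_reduce_line[OF line(1) res(1) pos line(2)
            disjoint_lines_excess[OF gp L line(1)]])
    moreover have "int (linsys_dim p (d - 1) (reduce_on I m)) = sec_lin_vdim 2 (d - 1) (reduce_on I m)"
      by (rule less.IH[OF _ res(2)]) (use res(1) in simp)
    ultimately show ?thesis using fixed_curve_dim[OF L fixed] by simp
  next
    case conic
    have fixed: "2 * d < sum m {1..5}" using conic unfolding conic_excess_eq by linarith
    note res = conic.fixed_curve_residual[OF L fixed]
    have pos: "1 \<le> m i" if i: "i \<in> {1..5}" for i
      using four_points_degree[OF gp L, of "{1..5} - {i}"] sum.remove[OF _ i, of m] i fixed by simp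
    have "int (linsys_dim p (d - 2) (reduce_on {1..5} m)) = sec_lin_vdim 2 (d - 2) (reduce_on {1..5} m)"
      by (rule less.IH[OF _ res(2)]) (use res(1) in simp)
    then show ?thesis
      using conic.fixed_curve_dim[OF L fixed] sec_lin_vdim_reduce_conic[OF res(1) pos conic] by simp
  next
    case nef
    have "sec_lin_vdim 2 d m = vdim 2 d m"
      using nef by (intro sec_lin_vdim_eq_vdim) force+
    moreover have "vdim 2 d m \<le> int (linsys_dim p d m)" by (rule linsys_dim_ge_vdim[OF gp])
    moreover have "int (linsys_dim p d m) \<le> vdim 2 d m"
    proof (cases "d = 0")
      case True
      have "m i = 0" if "i \<in> {1..5}" for i
        using multiplicity_le_degree[OF L that] True by simp
      then have "2 * vdim 2 d m = 2" unfolding vdim_2_double by (simp add: True)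
      then show ?thesis using linsys_dim_degree_0[of p m] by (simp add: True)
    next
      case False
      then have d: "1 \<le> d" by simp
      obtain i j where ij: "i \<in> {1..5}" "j \<in> {1..5}" "i \<noteq> j" "m j \<le> m i"
        "\<forall>l \<in> {1..5} - {i, j}. m l \<le> m j" by (rule two_largest[of m])
      define m' where "m' = reduce_on {i, j} m"
      have pair: "{i, j} \<in> index_pairs" using ij(1-3) by (simp add: index_pairs_def)
      then have sum_le: "m i + m j \<le> d" using nef(1)[of "{i, j}"] ij(3) by (simp add: line_excess_def)
      have nonneg: "0 \<le> vdim 2 (d - 1) m'"
        unfolding m'_def
        by (rule residual_vdim_nonneg[OF ij d]) (use sum_le nef(2) in \<open>simp_all add: conic_excess_def\<close>)
      have m'_le: "m' l \<le> m l" for l by (simp add: m'_def reduce_on_def)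
      have svdim: "sec_lin_vdim 2 (d - 1) m' = vdim 2 (d - 1) m'"
      proof (rule sec_lin_vdim_eq_vdim)
        fix I assume I: "I \<in> index_pairs"
        have "sum m' I \<le> sum m I" by (rule sum_mono) (rule m'_le)
        then show "line_excess (d - 1) m' I \<le> 1"
          using nef(1)[OF I] d unfolding line_excess_eq by linarith
      next
        show "conic_excess (d - 1) m' \<le> 1"
        proof (cases "m j = 0")
          case True
          have "m' l = 0" if "l \<in> {1..5} - {i}" for l
            using ij(5)[rule_format, of l] True m'_le[of l] that by (cases "l = j") auto
          moreover have "(\<Sum>l = 1..5. int (m' l)) = int (m' i) + (\<Sum>l\<in>{1..5} - {i}. int (m' l))"
            using ij(1) by (intro sum.remove) simp
          ultimately have "(\<Sum>l = 1..5. int (m' l)) = int (m' i)" by simp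
          then show ?thesis
            using sum_le m'_le[of i] d by (simp add: conic_excess_def)
        next
          case False
          then have "(\<Sum>l = 1..5. int (m' l)) = (\<Sum>l = 1..5. int (m l)) - int (card ({1..5} \<inter> {i, j}))"
            unfolding m'_def using ij(4) by (intro sum_reduce_pos) auto
          also have "{1..5} \<inter> {i, j} = {i, j}" using ij(1,2) by blast
          finally show ?thesis using nef(2) d ij(3) by (simp add: conic_excess_def)
        qed
      qed
      have empty: "linsys_dim p (d - 1) m' = 0" if "linsys p (d - 1) m' = {0}"
      proof -
        have "fun_vs.dim {0 :: complex^3 \<Rightarrow> complex} \<le> card ({} :: (complex^3 \<Rightarrow> complex) set)"
          by (rule fun_vs.dim_le_card) auto
        then show ?thesis unfolding linsys_dim_def that by simp
      qed
      have le: "int (linsys_dim p (d - 1) m') \<le> vdim 2 (d - 1) m'"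
      proof (cases "linsys p (d - 1) m' = {0}")
        case True
        then show ?thesis unfolding empty[OF True] using nonneg by simp
      next
        case False
        have "int (linsys_dim p (d - 1) m') = sec_lin_vdim 2 (d - 1) m'"
          by (rule less.IH[OF _ False]) (use d in simp)
        then show ?thesis unfolding svdim by simp
      qed
      obtain P' w' s' \<mu>' where "rational_curve p P' 1 w' {i, j} s' \<mu>'"
        using line_through_pair[OF gp pair] by metis
      then interpret rational_curve p P' 1 w' "{i, j}" s' \<mu>' .
      have "linsys_dim p d m \<le> linsys_dim p (d - 1) m' + (1 * d + 1 - sum m {i, j})"
        unfolding m'_def by (rule linsys_dim_le_reduced[OF d])
      also have "1 * d + 1 - sum m {i, j} = d + 1 - (m i + m j)" using ij(3) by simp
      finally have "int (linsys_dim p d m)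
          \<le> int (linsys_dim p (d - 1) m') + (int d + 1 - (int (m i) + int (m j)))"
        using sum_le by linarith
      moreover have "vdim 2 d m = vdim 2 (d - 1) m' + (int d + 1 - (int (m i) + int (m j)))"
        using vdim_reduce_line[OF d, of "{i, j}" m] ij(1-3) by (simp add: m'_def)
      ultimately show ?thesis using le by linarith
    qed
    ultimately show ?thesis by simp
  qed
qed

lemma (in rational_curve) vanishes_on_fixed_curve:
  assumes "e * d < sum m I" "\<And>x. x \<in> X \<Longrightarrow> P x = 0" "F \<in> linsys p d m" "x \<in> X"
  shows "F x = 0"
proof (cases "F = 0")
  case False
  obtain G where "F = P * G" by (rule fixed_curve_divides[OF assms(3) False assms(1)])
  then show ?thesis using assms(2)[OF assms(4)] by simp
qed simp

lemma form_vanishes_on_zariski_closure: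
  assumes "F \<in> forms d" "\<And>y. y \<in> X \<Longrightarrow> F y = 0" "x \<in> zariski_closure X" "x \<noteq> 0"
  shows "F x = 0"
  using assms unfolding zariski_closure_def by blast


theorem proposition6p10:
  fixes p :: "nat \<Rightarrow> complex^3" and C :: "(complex^3) set"
    and d :: nat and m :: "nat \<Rightarrow> nat"
  assumes "general_position p"
    and "rational_normal_curve C" and "\<forall>i \<in> {1..5}. p i \<in> C"
    and "linsys p d m \<noteq> {0}"
  shows "(special p d m \<longrightarrow>
            (\<exists>I. (I, 0) \<in> sec_indices 2 \<and> r_sec I 0 \<ge> 1 \<and>
                 linear_cycle p I \<subseteq> base_locus (linsys p d m)) \<or>
            (\<exists>I t. (I, t) \<in> sec_indices 2 \<and> t \<ge> 1 \<and>
                 proj_join (linear_cycle p I) (secant_variety C t) \<subseteq> base_locus (linsys p d m)))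
         \<and> int (linsys_dim p d m) = sec_ldim p d m"
proof
  obtain P w s \<mu> where curve: "rational_curve p P 2 w {1..5} s \<mu>"
    and PC: "\<And>x. x \<in> C \<Longrightarrow> P x = 0"
    using conic_through_points[OF assms(1-3)] by metis
  interpret conic: rational_curve p P 2 w "{1..5}" s \<mu> by (rule curve)
  note formula = linsys_dim_formula[OF assms(1) curve]
  show "int (linsys_dim p d m) = sec_ldim p d m"
  proof -
    have "0 \<le> sec_lin_vdim 2 d m'" if "linsys p d m \<subseteq> linsys p d m'" for m'
    proof -
      have "linsys p d m' \<noteq> {0}"
        using that assms(4) fun_vs.subspace_0[OF subspace_linsys, of p d m] by blast
      from formula[OF this] show ?thesis by linarith
    qed
    then have "\<not> (\<exists>m'. linsys p d m \<subseteq> linsys p d m' \<and> sec_lin_vdim 2 d m' < 0)"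
      by (meson not_le)
    then have "sec_ldim p d m = max (sec_lin_vdim 2 d m) 0"
      unfolding sec_ldim_def proj_dim_3 Let_def by (rule if_not_P)
    then show ?thesis using formula[OF assms(4)] by linarith
  qed
  show "special p d m \<longrightarrow>
      (\<exists>I. (I, 0) \<in> sec_indices 2 \<and> r_sec I 0 \<ge> 1 \<and>
           linear_cycle p I \<subseteq> base_locus (linsys p d m)) \<or>
      (\<exists>I t. (I, t) \<in> sec_indices 2 \<and> t \<ge> 1 \<and>
           proj_join (linear_cycle p I) (secant_variety C t) \<subseteq> base_locus (linsys p d m))"
  proof
    assume "special p d m"
    then have "vdim 2 d m < sec_lin_vdim 2 d m"
      using formula[OF assms(4)] unfolding special_def proj_dim_3 by linarith
    then consider (line) I where "I \<in> index_pairs" "0 < line_excess d m I"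
      | (conic) "0 < conic_excess d m"
      using sec_lin_vdim_eq_vdim[of d m] by force
    then show "(\<exists>I. (I, 0) \<in> sec_indices 2 \<and> r_sec I 0 \<ge> 1 \<and>
           linear_cycle p I \<subseteq> base_locus (linsys p d m)) \<or>
      (\<exists>I t. (I, t) \<in> sec_indices 2 \<and> t \<ge> 1 \<and>
           proj_join (linear_cycle p I) (secant_variety C t) \<subseteq> base_locus (linsys p d m))"
    proof cases
      case line
      obtain P' w' s' \<mu>' where curve': "rational_curve p P' 1 w' I s' \<mu>'"
        and P': "\<And>x. x \<in> vec.span (p ` I) \<Longrightarrow> P' x = 0"
        using line_through_pair[OF assms(1) line(1)] by metis
      interpret rational_curve p P' 1 w' I s' \<mu>' by (rule curve')
      have fixed: "1 * d < sum m I" using line(2) unfolding line_excess_eq by linarith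
      have "F x = 0" if "x \<in> vec.span (p ` I)" "F \<in> linsys p d m" for x F
        by (rule vanishes_on_fixed_curve[OF fixed P' that(2,1)])
      then have "linear_cycle p I \<subseteq> base_locus (linsys p d m)"
        by (auto simp: linear_cycle_def base_locus_def)
      moreover have "(I, 0) \<in> sec_indices 2" using line(1) by (simp add: sec_indices_2)
      moreover have "r_sec I 0 \<ge> 1" using line(1) by (simp add: r_sec_def index_pairs_def)
      ultimately show ?thesis by blast
    next
      case conic
      have fixed: "2 * d < sum m {1..5}" using conic unfolding conic_excess_eq by linarith
      have F_join: "F x = 0"
        if F: "F \<in> linsys p d m" and x: "x \<in> proj_join (linear_cycle p {}) (secant_variety C 1)" "x \<noteq> 0"
        for F x
      proof -
        have form: "F \<in> forms d" using F by (simp add: linsys_def)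
        \<comment> \<open>the secant variety \<open>\<sigma>\<^sub>1\<close> and its join with the empty set are still \<open>C\<close>, up to closures,
          and vanishing of \<open>F\<close> passes to Zariski closures\<close>
        have F_C: "F y = 0" if "y \<in> C" for y
          by (rule conic.vanishes_on_fixed_curve[OF fixed PC F that])
        have F_cone: "F y = 0" if c: "c \<in> C" and y: "y \<in> vec.span {c}" for c y
        proof -
          obtain k where "y = k *s c" using y vec.span_breakdown_eq[of y c "{}"] by auto
          then show ?thesis using forms_homogeneous[OF form, of k c] F_C[OF c] by simp
        qed
        have F_secant: "F y = 0" if y: "y \<in> secant_variety C 1" for y
        proof (cases "y = 0")
          case True
          have "p 1 \<in> C" using assms(3) by simp
          then show ?thesis using F_cone[of "p 1" y] True vec.span_zero by blast
        next
          case False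
          show ?thesis
          proof (rule form_vanishes_on_zariski_closure[OF form _ y[unfolded secant_variety_def] False])
            fix z assume "z \<in> (\<Union>c\<in>{c. \<forall>i<1::nat. c i \<in> C}. vec.span (c ` {..<1}))"
            then obtain c where c: "\<forall>i<1::nat. c i \<in> C" "z \<in> vec.span (c ` {..<1})" by blast
            have "{..<1::nat} = {0}" by auto
            with c(2) have "z \<in> vec.span {c 0}" by (simp only: image_insert image_empty)
            moreover have "c 0 \<in> C" using c(1) by simp
            ultimately show "F z = 0" using F_cone by blast
          qed
        qed
        show ?thesis
        proof (rule form_vanishes_on_zariski_closure[OF form _ x(1)[unfolded proj_join_def] x(2)])
          fix z assume "z \<in> {x + y |x y. x \<in> linear_cycle p {} \<and> y \<in> secant_variety C 1}"
          then show "F z = 0" using F_secant by (auto simp: linear_cycle_def)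
        qed
      qed
      then have "proj_join (linear_cycle p {}) (secant_variety C 1) \<subseteq> base_locus (linsys p d m)"
        by (auto simp: base_locus_def)
      moreover have "({}, 1) \<in> sec_indices 2" by (simp add: sec_indices_2)
      ultimately show ?thesis by blast
    qed
  qed
qed

end
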